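(* Suppose that $\varphi_1$ and $\varphi_2$ in $H^2(\mathbb{T}^d)$ depend on separate variables and that both $\mathbf{H}_{\varphi_1}$ and $\mathbf{H}_{\varphi_2}$ have minimal norm. (a) $\mathbf{H}_{\varphi_1\varphi_2}$ has minimal norm. (b) If additionally $\varphi_1(0)=\varphi_2(0)=0$, then $\mathbf{H}_{\varphi_1+\varphi_2}$ has minimal norm.
   Context: $\mathbb{T}^d$ is the $d$-dimensional torus with its normalized Haar measure. $H^2(\mathbb{T}^d)$ is the subspace of $L^2(\mathbb{T}^d)$ of functions whose Fourier coefficients are supported on $\mathbb{N}_0^d$, $\mathbb{N}_0=\{0,1,2,\ldots\}$, and $\overline{H^2}(\mathbb{T}^d)$ is the subspace of $L^2(\mathbb{T}^d)$ of complex conjugates of functions in $H^2(\mathbb{T}^d)$. Let $\overline{P}$ be the orthogonal projection from $L^2(\mathbb{T}^d)$ to $\overline{H^2}(\mathbb{T}^d)$. For $\varphi$ in $H^2(\mathbb{T}^d)$ the (small) Hankel operator $\mathbf{H}_\varphi$ from $H^2(\mathbb{T}^d)$ to $\overline{H^2}(\mathbb{T}^d)$ is $\mathbf{H}_\varphi f = \overline{P}(\overline{\varphi} f)$; it is initially defined for (analytic) polynomials $f$, and $\|\mathbf{H}_\varphi\|\in[0,\infty]$ denotes the supremum of $\|\mathbf{H}_\varphi f\|_{L^2}$ over polynomials $f$ with $\|f\|_{H^2}=1$ (the operator extends to a bounded operator on $H^2(\mathbb{T}^d)$ when this is finite). One always has $\|\mathbf{H}_\varphi\|\geq\|\varphi\|_{H^2(\mathbb{T}^d)}$,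 and $\mathbf{H}_\varphi$ is said to have minimal norm if $\|\mathbf{H}_\varphi\|=\|\varphi\|_{H^2(\mathbb{T}^d)}$. Two functions depend on separate variables if there are disjoint subsets $A_1,A_2$ of $\{1,\ldots,d\}$ such that $\varphi_j$ depends only on the variables $z_i$ with $i\in A_j$, for $j=1,2$. For $\varphi$ in $H^2(\mathbb{T}^d)$, $\varphi(0)$ denotes its zeroth Fourier coefficient (the value at the origin of its analytic extension to the polydisc). *)

theory Defs
  imports "HOL-Probability.Probability"
begin

definition circle :: "complex measure" where
  "circle = distr (uniform_measure lborel {0..2 * pi}) (restrict_space borel (sphere 0 1)) cis"

text \<open>Points of the \<open>d\<close>-dimensional torus are the extensional functions
  \<^term>\<open>z \<in> {1..d} \<rightarrow>\<^sub>E sphere 0 1\<close>; functions on the torus are total HOL functions whose values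
  outside this space are irrelevant.\<close>

definition torus :: "nat \<Rightarrow> (nat \<Rightarrow> complex) measure" where
  "torus d = (\<Pi>\<^sub>M i\<in>{1..d}. circle)"

lemma cis_measurable_circle:
  "cis \<in> uniform_measure lborel {0..2 * pi} \<rightarrow>\<^sub>M restrict_space borel (sphere 0 1)"
proof (rule measurable_restrict_space2)
  have "continuous_on UNIV cis"
    by (intro continuous_intros)
  then have "cis \<in> borel_measurable borel"
    by (rule borel_measurable_continuous_onI)
  then show "cis \<in> borel_measurable (uniform_measure lborel {0..2 * pi})"
    by (simp cong: measurable_cong_sets)
qed (auto simp: dist_norm)

lemma prob_space_circle: "prob_space circle"
  unfolding circle_def
  by (intro prob_space.prob_space_distr prob_space_uniform_measure cis_measurable_circle) auto

lemma space_torus: "space (torus d) = {1..d} \<rightarrow>\<^sub>E sphere 0 1"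
  by (simp add: torus_def circle_def space_PiM space_restrict_space)

lemma prob_space_torus: "prob_space (torus d)"
  unfolding torus_def by (intro prob_space_PiM prob_space_circle)

text \<open>Elements of \<open>L\<^sup>2\<close> are represented by functions, not by classes modulo null sets.\<close>

definition L2 :: "nat \<Rightarrow> ((nat \<Rightarrow> complex) \<Rightarrow> complex) set" where
  "L2 d = {f \<in> borel_measurable (torus d). integrable (torus d) (\<lambda>z. (cmod (f z))\<^sup>2)}"

definition L2_inner ::
    "nat \<Rightarrow> ((nat \<Rightarrow> complex) \<Rightarrow> complex) \<Rightarrow> ((nat \<Rightarrow> complex) \<Rightarrow> complex) \<Rightarrow> complex" where
  "L2_inner d f g = (LINT z|torus d. f z * cnj (g z))"

definition L2_norm :: "nat \<Rightarrow> ((nat \<Rightarrow> complex) \<Rightarrow> complex) \<Rightarrow> real" where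
  "L2_norm d f = sqrt (LINT z|torus d. (cmod (f z))\<^sup>2)"

text \<open>Multi-indices are functions on all of \<^typ>\<open>nat\<close>; only their values on \<^term>\<open>{1..d}\<close> matter.\<close>

definition character :: "nat \<Rightarrow> (nat \<Rightarrow> int) \<Rightarrow> (nat \<Rightarrow> complex) \<Rightarrow> complex" where
  "character d \<alpha> z = (\<Prod>i\<in>{1..d}. z i powi \<alpha> i)"

definition fourier_coeff :: "nat \<Rightarrow> ((nat \<Rightarrow> complex) \<Rightarrow> complex) \<Rightarrow> (nat \<Rightarrow> int) \<Rightarrow> complex" where
  "fourier_coeff d f \<alpha> = L2_inner d f (character d \<alpha>)"

definition H2 :: "nat \<Rightarrow> ((nat \<Rightarrow> complex) \<Rightarrow> complex) set" where
  "H2 d = {f \<in> L2 d. \<forall>\<alpha>. (\<exists>i\<in>{1..d}. \<alpha> i < 0) \<longrightarrow> fourier_coeff d f \<alpha> = 0}"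

definition conj_H2 :: "nat \<Rightarrow> ((nat \<Rightarrow> complex) \<Rightarrow> complex) set" where
  "conj_H2 d = (\<lambda>f z. cnj (f z)) ` H2 d"

definition analytic_polynomials :: "nat \<Rightarrow> ((nat \<Rightarrow> complex) \<Rightarrow> complex) set" where
  "analytic_polynomials d =
    {f. \<exists>S c. finite S \<and> (\<forall>\<alpha>\<in>S. \<forall>i\<in>{1..d}. 0 \<le> \<alpha> i) \<and>
          f = (\<lambda>z. \<Sum>\<alpha>\<in>S. c \<alpha> * character d \<alpha> z)}"

text \<open>The orthogonal projection is determined only up to a null set, so a representative is chosen;
  for \<^term>\<open>f \<in> L2 d\<close> one exists because \<^term>\<open>conj_H2 d\<close> is a closed subspace.\<close>

definition conj_proj ::
    "nat \<Rightarrow> ((nat \<Rightarrow> complex) \<Rightarrow> complex) \<Rightarrow> (nat \<Rightarrow> complex) \<Rightarrow> complex" where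
  "conj_proj d f =
    (SOME g. g \<in> conj_H2 d \<and> (\<forall>h\<in>conj_H2 d. L2_inner d (\<lambda>z. f z - g z) h = 0))"

definition hankel ::
    "nat \<Rightarrow> ((nat \<Rightarrow> complex) \<Rightarrow> complex) \<Rightarrow> ((nat \<Rightarrow> complex) \<Rightarrow> complex)
      \<Rightarrow> (nat \<Rightarrow> complex) \<Rightarrow> complex" where
  "hankel d \<phi> f = conj_proj d (\<lambda>z. cnj (\<phi> z) * f z)"

definition hankel_norm :: "nat \<Rightarrow> ((nat \<Rightarrow> complex) \<Rightarrow> complex) \<Rightarrow> ennreal" where
  "hankel_norm d \<phi> =
    (SUP f \<in> {f \<in> analytic_polynomials d. L2_norm d f = 1}. ennreal (L2_norm d (hankel d \<phi> f)))"

definition hankel_minimal_norm :: "nat \<Rightarrow> ((nat \<Rightarrow> complex) \<Rightarrow> complex) \<Rightarrow> bool" where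
  "hankel_minimal_norm d \<phi> \<longleftrightarrow> \<phi> \<in> H2 d \<and> hankel_norm d \<phi> = ennreal (L2_norm d \<phi>)"

text \<open>Dependence on a set of variables is a property of the class modulo null sets: some
  measurable representative depends on these variables only.\<close>

definition depends_only_on :: "nat \<Rightarrow> nat set \<Rightarrow> ((nat \<Rightarrow> complex) \<Rightarrow> complex) \<Rightarrow> bool" where
  "depends_only_on d A f \<longleftrightarrow>
    (\<exists>g\<in>borel_measurable (torus d).
      (\<forall>z\<in>space (torus d). \<forall>w\<in>space (torus d). (\<forall>i\<in>A. z i = w i) \<longrightarrow> g z = g w) \<and>
      (AE z in torus d. f z = g z))"

definition separate_variables ::
    "nat \<Rightarrow> ((nat \<Rightarrow> complex) \<Rightarrow> complex) \<Rightarrow> ((nat \<Rightarrow> complex) \<Rightarrow> complex) \<Rightarrow> bool" where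
  "separate_variables d f g \<longleftrightarrow>
    (\<exists>A B. A \<subseteq> {1..d} \<and> B \<subseteq> {1..d} \<and> A \<inter> B = {} \<and> depends_only_on d A f \<and> depends_only_on d B g)"

end

theory Submission
  imports Defs "HOL-Library.Function_Algebras"
begin

text \<open>By Parseval's identity \<open>\<parallel>H\<^sub>\<phi> f\<parallel>\<^sup>2\<close> is the sum over \<open>\<beta> \<ge> 0\<close> of the squares of
  \<open>\<Sum>\<^sub>\<alpha> f\<^sub>\<alpha> cnj (\<phi>\<^sub>\<alpha>\<^sub>+\<^sub>\<beta>)\<close>, in terms of the Fourier coefficients of \<open>f\<close> and \<open>\<phi>\<close>. Hence \<open>H\<^sub>\<phi>\<close> has minimal norm
  if and only if every finite section of the matrix \<open>(cnj (\<phi>\<^sub>\<alpha>\<^sub>+\<^sub>\<beta>))\<close> has norm at most \<open>\<parallel>\<phi>\<parallel>\<close>.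

  If \<open>\<phi>\<^sub>1\<close> and \<open>\<phi>\<^sub>2\<close> depend on separate variables, the matrix of \<open>\<phi>\<^sub>1 \<phi>\<^sub>2\<close> is the tensor product of the two
  matrices, and \<open>\<parallel>\<phi>\<^sub>1 \<phi>\<^sub>2\<parallel> = \<parallel>\<phi>\<^sub>1\<parallel> \<parallel>\<phi>\<^sub>2\<parallel>\<close>. If moreover the constant coefficients vanish, then
  \<open>\<parallel>\<phi>\<^sub>1 + \<phi>\<^sub>2\<parallel>\<^sup>2 = \<parallel>\<phi>\<^sub>1\<parallel>\<^sup>2 + \<parallel>\<phi>\<^sub>2\<parallel>\<^sup>2\<close>, and the matrix of \<open>\<phi>\<^sub>1 + \<phi>\<^sub>2\<close> consists of two blocks that share only the row
  and the column of the index \<open>0\<close>. On this row the two blocks contribute \<open>p\<close> and \<open>q\<close>, and the excess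
  \<open>2 |p| |q|\<close> of \<open>|p + q|\<^sup>2\<close> over \<open>|p|\<^sup>2 + |q|\<^sup>2\<close> is absorbed by the inequality
  \<open>2 |p| |q| \<le> \<parallel>\<phi>\<^sub>1\<parallel>\<^sup>2 v + \<parallel>\<phi>\<^sub>2\<parallel>\<^sup>2 u\<close>, where \<open>u\<close> and \<open>v\<close> are the squared norms of the two parts of \<open>f\<close>.\<close>

section \<open>Square integrable functions on the torus\<close>


lemma torus_component_measurable [measurable]:
  assumes "i \<in> {1..d}"
  shows "(\<lambda>z. z i) \<in> borel_measurable (torus d)"
proof -
  have "(\<lambda>z. z i) \<in> torus d \<rightarrow>\<^sub>M circle"
    unfolding torus_def using assms by (rule measurable_component_singleton)
  moreover have "(\<lambda>x. x) \<in> circle \<rightarrow>\<^sub>M borel"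
    by (simp add: circle_def measurable_restrict_space1)
  ultimately show ?thesis
    by (rule measurable_compose)
qed

lemma power_int_measurable [measurable (raw)]:
  fixes f :: "'a \<Rightarrow> complex"
  assumes [measurable]: "f \<in> borel_measurable M"
  shows "(\<lambda>x. f x powi k) \<in> borel_measurable M"
  by (cases "0 \<le> k") (auto simp: power_int_def)

lemma character_measurable [measurable]: "character d \<alpha> \<in> borel_measurable (torus d)"
  unfolding character_def[abs_def] by (intro borel_measurable_prod power_int_measurable torus_component_measurable)

lemma norm_torus_component: "z \<in> space (torus d) \<Longrightarrow> i \<in> {1..d} \<Longrightarrow> cmod (z i) = 1"
  by (auto simp: space_torus dest!: PiE_mem)

lemma norm_character: "z \<in> space (torus d) \<Longrightarrow> cmod (character d \<alpha> z) = 1"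
  unfolding character_def by (simp add: prod_norm[symmetric] norm_power_int norm_torus_component)

lemma character_add:
  "z \<in> space (torus d) \<Longrightarrow> character d (\<alpha> + \<beta>) z = character d \<alpha> z * character d \<beta> z"
proof -
  assume z: "z \<in> space (torus d)"
  have "z i powi (\<alpha> + \<beta>) i = z i powi \<alpha> i * z i powi \<beta> i" if "i \<in> {1..d}" for i
    using norm_torus_component[OF z that] by (subst plus_fun_apply, intro power_int_add) auto
  then show ?thesis
    unfolding character_def prod.distrib[symmetric] by (intro prod.cong refl) auto
qed

text \<open>A character has modulus 1 on the torus, so its conjugate is its inverse, and by
  \<open>character_add\<close> the inverse is the character with negated exponents.\<close>

lemma cnj_character:
  "z \<in> space (torus d) \<Longrightarrow> cnj (character d \<alpha> z) = character d (- \<alpha>) z"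
proof -
  assume z: "z \<in> space (torus d)"
  have "character d \<alpha> z * character d (- \<alpha>) z = 1"
    using character_add[OF z, of \<alpha> "- \<alpha>"] by (simp add: character_def)
  moreover have "character d \<alpha> z * cnj (character d \<alpha> z) = 1"
    using norm_character[OF z, of \<alpha>] by (simp add: complex_norm_square[symmetric])
  ultimately show ?thesis
    by (metis mult_cancel_left mult_zero_left zero_neq_one)
qed

lemma character_zero [simp]: "character d 0 z = 1"
  by (simp add: character_def)

lemma character_cong: "(\<And>i. i \<in> {1..d} \<Longrightarrow> \<alpha> i = \<beta> i) \<Longrightarrow> character d \<alpha> = character d \<beta>"
  by (auto simp: character_def fun_eq_iff intro!: prod.cong)

lemma fourier_coeff_cong:
  "(\<And>i. i \<in> {1..d} \<Longrightarrow> \<alpha> i = \<beta> i) \<Longrightarrow> fourier_coeff d f \<alpha> = fourier_coeff d f \<beta>"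
  unfolding fourier_coeff_def using character_cong by metis

interpretation torus: prob_space "torus d" for d
  by (rule prob_space_torus)

section \<open>Closure properties of \<open>L2 d\<close>\<close>

lemma L2_measurable: "f \<in> L2 d \<Longrightarrow> f \<in> borel_measurable (torus d)"
  and L2_integrable_square: "f \<in> L2 d \<Longrightarrow> integrable (torus d) (\<lambda>z. (cmod (f z))\<^sup>2)"
  by (auto simp: L2_def)

lemma L2_integrable_mult:
  assumes "f \<in> L2 d" "g \<in> L2 d"
  shows "integrable (torus d) (\<lambda>z. f z * g z)"
proof (rule Bochner_Integration.integrable_bound)
  note [measurable] = L2_measurable[OF assms(1)] L2_measurable[OF assms(2)]
  show "integrable (torus d) (\<lambda>z. (cmod (f z))\<^sup>2 + (cmod (g z))\<^sup>2)"
    using assms by (auto simp: L2_integrable_square)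
  show "(\<lambda>z. f z * g z) \<in> borel_measurable (torus d)" by measurable
  show "AE z in torus d. norm (f z * g z) \<le> norm ((cmod (f z))\<^sup>2 + (cmod (g z))\<^sup>2)"
  proof (rule AE_I2)
    fix z
    have "2 * (cmod (f z) * cmod (g z)) \<le> (cmod (f z))\<^sup>2 + (cmod (g z))\<^sup>2"
      using sum_squares_bound[of "cmod (f z)" "cmod (g z)"] by (simp add: mult.assoc)
    moreover have "0 \<le> cmod (f z) * cmod (g z)" by simp
    ultimately show "norm (f z * g z) \<le> norm ((cmod (f z))\<^sup>2 + (cmod (g z))\<^sup>2)"
      unfolding norm_mult real_norm_def by linarith
  qed
qed

text \<open>A product of two square integrable functions is in general only integrable
  (\<open>L2_integrable_mult\<close>). With a bounded factor it stays in \<open>L2 d\<close>, which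
  makes \<open>cnj (\<phi> z) * f z\<close> an admissible argument of the projection for every
  polynomial \<open>f\<close>.\<close>

lemma L2_bounded_mult:
  assumes f: "f \<in> L2 d" and [measurable]: "g \<in> borel_measurable (torus d)"
    and B: "\<And>z. z \<in> space (torus d) \<Longrightarrow> cmod (g z) \<le> B"
  shows "(\<lambda>z. f z * g z) \<in> L2 d"
proof -
  note [measurable] = L2_measurable[OF f]
  have "integrable (torus d) (\<lambda>z. (cmod (f z * g z))\<^sup>2)"
  proof (rule Bochner_Integration.integrable_bound)
    show "integrable (torus d) (\<lambda>z. B\<^sup>2 * (cmod (f z))\<^sup>2)"
      using f by (auto simp: L2_integrable_square)
    show "AE z in torus d. norm ((cmod (f z * g z))\<^sup>2) \<le> norm (B\<^sup>2 * (cmod (f z))\<^sup>2)"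
      by (intro AE_I2) (auto simp: norm_mult power_mult_distrib mult.commute[of "B\<^sup>2"]
        intro!: mult_left_mono power_mono B)
  qed measurable
  then show ?thesis by (auto simp: L2_def)
qed

lemma L2_bounded:
  assumes [measurable]: "g \<in> borel_measurable (torus d)"
    and B: "\<And>z. z \<in> space (torus d) \<Longrightarrow> cmod (g z) \<le> B"
  shows "g \<in> L2 d"
  using L2_bounded_mult[of "\<lambda>_. 1" d g B] assms by (auto simp: L2_def)

lemma character_L2: "character d \<alpha> \<in> L2 d"
  by (rule L2_bounded[where B = 1]) (auto simp: norm_character)

lemma L2_cnj: "f \<in> L2 d \<Longrightarrow> (\<lambda>z. cnj (f z)) \<in> L2 d"
proof -
  assume f: "f \<in> L2 d"
  note [measurable] = L2_measurable[OF f]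
  have "(\<lambda>z. cnj (f z)) \<in> borel_measurable (torus d)"
    by (rule borel_measurable_continuous_on[where f = cnj]) (auto intro!: continuous_intros)
  with f show ?thesis by (simp add: L2_def)
qed

lemma L2_cmult: "f \<in> L2 d \<Longrightarrow> (\<lambda>z. c * f z) \<in> L2 d"
  using L2_bounded_mult[of f d "\<lambda>_. c" "cmod c"] by (simp add: mult.commute)

lemma L2_add:
  assumes "f \<in> L2 d" "g \<in> L2 d"
  shows "(\<lambda>z. f z + g z) \<in> L2 d"
proof -
  note [measurable] = L2_measurable[OF assms(1)] L2_measurable[OF assms(2)]
  have "integrable (torus d) (\<lambda>z. (cmod (f z + g z))\<^sup>2)"
  proof (rule Bochner_Integration.integrable_bound)
    show "integrable (torus d) (\<lambda>z. 2 * (cmod (f z))\<^sup>2 + 2 * (cmod (g z))\<^sup>2)"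
      using assms by (auto simp: L2_integrable_square)
    show "AE z in torus d. norm ((cmod (f z + g z))\<^sup>2) \<le> norm (2 * (cmod (f z))\<^sup>2 + 2 * (cmod (g z))\<^sup>2)"
    proof (rule AE_I2)
      fix z
      have "(cmod (f z + g z))\<^sup>2 \<le> (cmod (f z) + cmod (g z))\<^sup>2"
        by (intro power_mono norm_triangle_ineq) auto
      also have "\<dots> \<le> 2 * (cmod (f z))\<^sup>2 + 2 * (cmod (g z))\<^sup>2"
        using sum_squares_bound[of "cmod (f z)" "cmod (g z)"] by (simp add: power2_sum)
      finally show "norm ((cmod (f z + g z))\<^sup>2) \<le> norm (2 * (cmod (f z))\<^sup>2 + 2 * (cmod (g z))\<^sup>2)"
        by simp
    qed
  qed measurable
  then show ?thesis by (auto simp: L2_def)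
qed

lemma L2_diff:
  assumes "f \<in> L2 d" "g \<in> L2 d"
  shows "(\<lambda>z. f z - g z) \<in> L2 d"
  using L2_add[OF assms(1) L2_cmult[OF assms(2), of "-1"]] by simp

lemma L2_sum:
  assumes "\<And>i. i \<in> S \<Longrightarrow> f i \<in> L2 d"
  shows "(\<lambda>z. \<Sum>i\<in>S. f i z) \<in> L2 d"
  using assms
proof (induction S rule: infinite_finite_induct)
  case (insert x F)
  then show ?case using L2_add[of "f x" d "\<lambda>z. \<Sum>i\<in>F. f i z"] by auto
qed (auto simp: L2_def)

lemma L2_integrable_inner: "f \<in> L2 d \<Longrightarrow> g \<in> L2 d \<Longrightarrow> integrable (torus d) (\<lambda>z. f z * cnj (g z))"
  by (intro L2_integrable_mult L2_cnj)

section \<open>Inner product and norm\<close>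

lemma L2_inner_add: "f \<in> L2 d \<Longrightarrow> g \<in> L2 d \<Longrightarrow> h \<in> L2 d \<Longrightarrow>
    L2_inner d (\<lambda>z. f z + g z) h = L2_inner d f h + L2_inner d g h"
  by (simp add: L2_inner_def ring_distribs L2_integrable_inner)

lemma L2_inner_diff: "f \<in> L2 d \<Longrightarrow> g \<in> L2 d \<Longrightarrow> h \<in> L2 d \<Longrightarrow>
    L2_inner d (\<lambda>z. f z - g z) h = L2_inner d f h - L2_inner d g h"
  by (simp add: L2_inner_def ring_distribs L2_integrable_inner)

lemma L2_inner_cmult: "L2_inner d (\<lambda>z. c * f z) h = c * L2_inner d f h"
  by (simp add: L2_inner_def mult.assoc)

lemma L2_inner_sum: "(\<And>i. i \<in> S \<Longrightarrow> f i \<in> L2 d) \<Longrightarrow> h \<in> L2 d \<Longrightarrow>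
    L2_inner d (\<lambda>z. \<Sum>i\<in>S. f i z) h = (\<Sum>i\<in>S. L2_inner d (f i) h)"
  by (simp add: L2_inner_def sum_distrib_right L2_integrable_inner)

lemma L2_inner_cnj: "cnj (L2_inner d f g) = L2_inner d g f"
proof -
  have "cnj (L2_inner d f g) = (LINT z|torus d. cnj (f z * cnj (g z)))"
    unfolding L2_inner_def by (rule Bochner_Integration.integral_cnj[symmetric])
  then show ?thesis by (simp add: L2_inner_def mult.commute)
qed

lemma L2_inner_self: "L2_inner d f f = of_real ((L2_norm d f)\<^sup>2)"
proof -
  have "L2_inner d f f = (LINT z|torus d. of_real ((cmod (f z))\<^sup>2))"
    unfolding L2_inner_def complex_norm_square ..
  also have "\<dots> = of_real (LINT z|torus d. (cmod (f z))\<^sup>2)"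
    by (rule integral_complex_of_real)
  finally show ?thesis by (simp add: L2_norm_def)
qed

lemma L2_norm_nonneg [simp]: "0 \<le> L2_norm d f"
  by (simp add: L2_norm_def)

lemma L2_norm_square: "(L2_norm d f)\<^sup>2 = (LINT z|torus d. (cmod (f z))\<^sup>2)"
  by (simp add: L2_norm_def)

text \<open>Serves in both directions: orthogonality gives Pythagoras' theorem, and additivity of
  the squared norms forces the real part of the inner product to vanish.\<close>

lemma L2_norm_add_square:
  assumes "f \<in> L2 d" "g \<in> L2 d"
  shows "(L2_norm d (\<lambda>z. f z + g z))\<^sup>2 = (L2_norm d f)\<^sup>2 + (L2_norm d g)\<^sup>2 + 2 * Re (L2_inner d f g)"
proof -
  have "(cmod (f z + g z))\<^sup>2 = (cmod (f z))\<^sup>2 + (cmod (g z))\<^sup>2 + 2 * Re (f z * cnj (g z))" for z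
    unfolding cmod_power2 by (simp add: power2_eq_square algebra_simps)
  then have "(L2_norm d (\<lambda>z. f z + g z))\<^sup>2 =
      (LINT z|torus d. (cmod (f z))\<^sup>2 + (cmod (g z))\<^sup>2 + 2 * Re (f z * cnj (g z)))"
    by (simp add: L2_norm_square)
  also have "\<dots> = (LINT z|torus d. (cmod (f z))\<^sup>2) + (LINT z|torus d. (cmod (g z))\<^sup>2)
      + 2 * (LINT z|torus d. Re (f z * cnj (g z)))"
    using assms by (simp add: L2_integrable_square L2_integrable_inner del: times_complex.sel)
  also have "(LINT z|torus d. Re (f z * cnj (g z))) = Re (L2_inner d f g)"
    unfolding L2_inner_def using assms by (intro integral_Re L2_integrable_inner)
  finally show ?thesis by (simp add: L2_norm_square)
qed

text \<open>Cauchy-Schwarz against the constant 1, read as nonnegativity of the variance of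
  \<open>norm (f x)\<close>. It puts \<open>L2 d\<close> inside the integrable functions and turns
  rates in mean square into rates in mean.\<close>

lemma (in prob_space) norm_integral_le_square:
  fixes f :: "'a \<Rightarrow> 'b :: {banach, second_countable_topology}"
  assumes [measurable]: "f \<in> borel_measurable M" and sq: "integrable M (\<lambda>x. (norm (f x))\<^sup>2)"
  shows "integrable M f" and "(LINT x|M. norm (f x))\<^sup>2 \<le> (LINT x|M. (norm (f x))\<^sup>2)"
proof -
  have i: "integrable M (\<lambda>x. norm (f x))"
    using square_integrable_imp_integrable[of "\<lambda>x. norm (f x)"] sq by auto
  then show "integrable M f" by (simp add: integrable_norm_iff)
  have "0 \<le> variance (\<lambda>x. norm (f x))" by simp
  also have "\<dots> = (LINT x|M. (norm (f x))\<^sup>2) - (LINT x|M. norm (f x))\<^sup>2"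
    using variance_eq[OF i sq] .
  finally show "(LINT x|M. norm (f x))\<^sup>2 \<le> (LINT x|M. (norm (f x))\<^sup>2)" by simp
qed


section \<open>Orthonormality of the characters\<close>

interpretation circle: prob_space circle
  by (rule prob_space_circle)

interpretation circles: product_prob_space "\<lambda>_. circle" I for I :: "nat set"
  by unfold_locales

lemma integral_circle:
  fixes f :: "complex \<Rightarrow> complex"
  assumes [measurable]: "f \<in> borel_measurable borel"
  shows "(LINT z|circle. f z) = (LINT t:{0..2 * pi}|lborel. f (cis t)) / (2 * pi)"
proof -
  have [measurable]: "f \<in> borel_measurable (restrict_space borel (sphere 0 1))"
    by (rule measurable_restrict_space1) fact
  have "cis \<in> borel_measurable borel"
    by (intro borel_measurable_continuous_onI continuous_intros)
  note [measurable] = this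
  have "indicator {0..2 * pi} t / emeasure lborel {0..2 * pi} = ennreal (indicator {0..2 * pi} t / (2 * pi))" for t
    using divide_ennreal[of 1 "2 * pi"] by (simp add: indicator_def)
  then have u: "uniform_measure lborel {0..2 * pi} = density lborel (\<lambda>t. ennreal (indicator {0..2 * pi} t / (2 * pi)))"
    unfolding uniform_measure_def by simp
  have "(LINT z|circle. f z) = (LINT t|uniform_measure lborel {0..2 * pi}. f (cis t))"
    unfolding circle_def by (rule integral_distr[OF cis_measurable_circle]) measurable
  also have "\<dots> = (LINT t|lborel. (indicator {0..2 * pi} t / (2 * pi)) *\<^sub>R f (cis t))"
    unfolding u by (rule integral_density) auto
  also have "\<dots> = (LINT t|lborel. (indicator {0..2 * pi} t *\<^sub>R f (cis t)) / (2 * pi))"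
    by (simp add: scaleR_conv_of_real)
  finally show ?thesis by (simp add: set_lebesgue_integral_def)
qed

text \<open>For nonzero \<open>k\<close>, \<open>cis (of_int k * t)\<close> has the antiderivative
  \<open>cis (of_int k * t) / (\<i> * of_int k)\<close>, which takes the same value at both ends of
  the period.\<close>

lemma integral_circle_powi: "(LINT z|circle. z powi k) = (if k = 0 then 1 else 0)"
proof (cases "k = 0")
  case True
  then show ?thesis by (simp add: circle.prob_space)
next
  case False
  have "(\<integral>t. indicator {0..2 * pi} t *\<^sub>R cis (of_int k * t) \<partial>lborel) =
      cis (of_int k * (2 * pi)) / (\<i> * of_int k) - cis (of_int k * 0) / (\<i> * of_int k)"
  proof (rule integral_FTC_Icc)
    fix t :: real
    have "((\<lambda>t. exp (\<i> * of_int k * of_real t)) has_vector_derivative (\<i> * of_int k) * exp (\<i> * of_int k * of_real t))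
        (at t within {0..2 * pi})"
      by (auto intro!: derivative_eq_intros has_vector_derivative_real_field simp: mult.commute)
    then have "((\<lambda>t. exp (\<i> * of_int k * of_real t) / (\<i> * of_int k)) has_vector_derivative
        (\<i> * of_int k) * exp (\<i> * of_int k * of_real t) / (\<i> * of_int k)) (at t within {0..2 * pi})"
      by (rule has_vector_derivative_divide)
    then show "((\<lambda>t. cis (of_int k * t) / (\<i> * of_int k)) has_vector_derivative cis (of_int k * t)) (at t within {0..2 * pi})"
      using False by (simp add: cis_conv_exp mult.assoc)
  qed (auto intro!: continuous_intros)
  also have "cis (of_int k * (2 * pi)) = 1"
    using cis_multiple_2pi[of "of_int k"] by (simp add: mult_ac)
  finally show ?thesis
    using False by (subst integral_circle) (auto simp: set_lebesgue_integral_def cis_power_int)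
qed

text \<open>By Fubini the integral is a product over the variables, and a single variable with
  nonzero exponent annihilates it.\<close>

lemma integral_character: "(LINT z|torus d. character d \<alpha> z) = (if \<forall>i\<in>{1..d}. \<alpha> i = 0 then 1 else 0)"
proof -
  have "integrable circle (\<lambda>z. z powi k)" for k
  proof (rule circle.integrable_const_bound[where B = 1])
    show "(\<lambda>z. z powi k) \<in> borel_measurable circle"
      unfolding circle_def by (simp, intro measurable_restrict_space1) measurable
    show "AE z in circle. cmod (z powi k) \<le> 1"
      by (auto intro!: AE_I2 simp: circle_def space_restrict_space norm_power_int)
  qed
  then have "(LINT z|torus d. character d \<alpha> z) = (\<Prod>i\<in>{1..d}. LINT z|circle. z powi \<alpha> i)"
    unfolding character_def torus_def by (intro circles.product_integral_prod) auto
  then show ?thesis by (auto simp: integral_circle_powi)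
qed

lemma fourier_coeff_character:
  "fourier_coeff d (character d \<alpha>) \<beta> = (if \<forall>i\<in>{1..d}. \<alpha> i = \<beta> i then 1 else 0)"
proof -
  have "fourier_coeff d (character d \<alpha>) \<beta> = (LINT z|torus d. character d (\<alpha> - \<beta>) z)"
    unfolding fourier_coeff_def L2_inner_def
    by (intro Bochner_Integration.integral_cong refl) (simp add: cnj_character character_add[symmetric])
  then show ?thesis by (simp add: integral_character)
qed

lemma fourier_coeff_eq_integral: "fourier_coeff d f \<alpha> = (LINT z|torus d. f z * character d (- \<alpha>) z)"
  unfolding fourier_coeff_def L2_inner_def
  by (intro Bochner_Integration.integral_cong refl) (simp add: cnj_character)

text \<open>Completeness of \<open>L\<^sup>2\<close> for fast Cauchy sequences: the increments are summable in \<open>L\<^sup>1\<close>, hence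
  almost everywhere, and Fatou's lemma controls the distance to the pointwise limit.\<close>

lemma (in prob_space) complete_square_integrable:
  fixes s :: "nat \<Rightarrow> 'a \<Rightarrow> 'b :: {banach, second_countable_topology}"
  assumes meas [measurable]: "\<And>n. s n \<in> borel_measurable M"
    and sq: "\<And>m n. integrable M (\<lambda>x. (norm (s m x - s n x))\<^sup>2)"
    and cauchy: "\<And>m n. n \<le> m \<Longrightarrow> (LINT x|M. (norm (s m x - s n x))\<^sup>2) \<le> (1 / 4) ^ n"
  obtains g where "g \<in> borel_measurable M"
    and "\<And>n. integrable M (\<lambda>x. (norm (g x - s n x))\<^sup>2)"
    and "\<And>n. (LINT x|M. (norm (g x - s n x))\<^sup>2) \<le> (1 / 4) ^ n"
proof
  \<comment> \<open>Where the sequence diverges, \<open>lim\<close> is an unspecified value; this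
    concerns a null set only, and \<open>g\<close> is measurable all the same.\<close>
  define g where "g x = lim (\<lambda>n. s n x)" for x
  show g_meas [measurable]: "g \<in> borel_measurable M"
    unfolding g_def[abs_def] by (rule borel_measurable_lim_metric) measurable
  define D where "D n x = s (Suc n) x - s n x" for n x
  have D_meas [measurable]: "D n \<in> borel_measurable M" for n
    unfolding D_def[abs_def] by measurable
  have D1: "integrable M (D n)" and D2: "(LINT x|M. norm (D n x)) \<le> (1 / 2) ^ n" for n
  proof -
    have i: "integrable M (\<lambda>x. (norm (D n x))\<^sup>2)" unfolding D_def by (rule sq)
    show "integrable M (D n)" by (rule norm_integral_le_square[OF _ i]) measurable
    have "(LINT x|M. norm (D n x))\<^sup>2 \<le> (LINT x|M. (norm (D n x))\<^sup>2)"
      by (rule norm_integral_le_square[OF _ i]) measurable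
    also have "\<dots> \<le> (1 / 4) ^ n" unfolding D_def by (rule cauchy) simp
    \<comment> \<open>The rate 1/4 in mean square becomes the rate 1/2 in mean, which is still
      summable.\<close>
    also have "(1 / 4) ^ n = ((1 / 2 :: real) ^ n)\<^sup>2"
      by (simp add: power2_eq_square power_mult_distrib[symmetric])
    finally show "(LINT x|M. norm (D n x)) \<le> (1 / 2) ^ n" by (rule power2_le_imp_le) simp
  qed
  have "(\<integral>\<^sup>+ x. (\<Sum>n. ennreal (norm (D n x))) \<partial>M) = (\<Sum>n. \<integral>\<^sup>+ x. ennreal (norm (D n x)) \<partial>M)"
    by (rule nn_integral_suminf) measurable
  also have "\<dots> \<le> (\<Sum>n. ennreal ((1 / 2) ^ n))"
    using D1 D2 by (intro suminf_le) (auto simp: nn_integral_eq_integral ennreal_leI)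
  also have "\<dots> = ennreal (\<Sum>n. (1 / 2) ^ n)"
    by (intro suminf_ennreal2) (auto simp: summable_geometric)
  finally have "(\<integral>\<^sup>+ x. (\<Sum>n. ennreal (norm (D n x))) \<partial>M) \<noteq> \<infinity>"
    by (auto simp: top_unique)
  then have "AE x in M. (\<Sum>n. ennreal (norm (D n x))) \<noteq> \<infinity>"
    by (intro nn_integral_PInf_AE) measurable
  then have lim: "AE x in M. (\<lambda>n. s n x) \<longlonglongrightarrow> g x"
  proof eventually_elim
    fix x assume "(\<Sum>n. ennreal (norm (D n x))) \<noteq> \<infinity>"
    then have "summable (\<lambda>n. norm (D n x))"
      by (intro summable_suminf_not_top) auto
    then have "summable (\<lambda>n. D n x)" by (rule summable_norm_cancel)
    then have "convergent (\<lambda>n. \<Sum>i<n. D i x)" by (simp add: summable_iff_convergent)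
    then have "convergent (\<lambda>n. s n x - s 0 x)"
      unfolding D_def by (simp only: sum_lessThan_telescope[of "\<lambda>i. s i x"])
    then have "convergent (\<lambda>n. s n x)"
      by (rule convergent_diff_const_right_iff[THEN iffD1])
    then show "(\<lambda>n. s n x) \<longlonglongrightarrow> g x" by (simp add: convergent_LIMSEQ_iff g_def)
  qed
  fix n
  have "(\<integral>\<^sup>+ x. ennreal ((norm (g x - s n x))\<^sup>2) \<partial>M) =
      (\<integral>\<^sup>+ x. liminf (\<lambda>m. ennreal ((norm (s m x - s n x))\<^sup>2)) \<partial>M)"
  proof (rule nn_integral_cong_AE, use lim in eventually_elim)
    fix x assume "(\<lambda>n. s n x) \<longlonglongrightarrow> g x"
    then have "(\<lambda>m. ennreal ((norm (s m x - s n x))\<^sup>2)) \<longlonglongrightarrow> ennreal ((norm (g x - s n x))\<^sup>2)"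
      by (intro tendsto_intros)
    then show "ennreal ((norm (g x - s n x))\<^sup>2) = liminf (\<lambda>m. ennreal ((norm (s m x - s n x))\<^sup>2))"
      by (rule lim_imp_Liminf[OF trivial_limit_sequentially, symmetric])
  qed
  also have "\<dots> \<le> liminf (\<lambda>m. \<integral>\<^sup>+ x. ennreal ((norm (s m x - s n x))\<^sup>2) \<partial>M)"
    by (rule nn_integral_liminf) measurable
  also have "\<dots> \<le> ennreal ((1 / 4) ^ n)"
  proof (rule Liminf_le)
    show "\<forall>\<^sub>F m in sequentially. (\<integral>\<^sup>+ x. ennreal ((norm (s m x - s n x))\<^sup>2) \<partial>M) \<le> ennreal ((1 / 4) ^ n)"
      using eventually_ge_at_top[of n]
      by eventually_elim (auto simp: nn_integral_eq_integral sq intro!: ennreal_leI cauchy)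
  qed simp
  finally have le: "(\<integral>\<^sup>+ x. ennreal ((norm (g x - s n x))\<^sup>2) \<partial>M) \<le> ennreal ((1 / 4) ^ n)" .
  then show i: "integrable M (\<lambda>x. (norm (g x - s n x))\<^sup>2)"
    by (intro integrableI_bounded) (auto simp: less_top[symmetric] top_unique)
  from le show "(LINT x|M. (norm (g x - s n x))\<^sup>2) \<le> (1 / 4) ^ n"
    by (subst (asm) nn_integral_eq_integral[OF i]) (auto simp: ennreal_le_iff)
qed


section \<open>Completeness of the characters\<close>

text \<open>Agreement is required on the unit circle only: there \<open>z powi (-1)\<close> equals
  \<open>cnj z\<close>, so that real-linear functions count as trigonometric polynomials.\<close>

definition trig_poly :: "(complex \<Rightarrow> complex) \<Rightarrow> bool" where
  "trig_poly p \<longleftrightarrow> (\<exists>S c. finite S \<and> (\<forall>z\<in>sphere 0 1. p z = (\<Sum>k\<in>S. c k * z powi k)))"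

lemma trig_poly_powi: "trig_poly (\<lambda>z. c * z powi k)"
  unfolding trig_poly_def by (intro exI[of _ "{k}"] exI[of _ "\<lambda>_. c"]) simp

lemma trig_poly_const: "trig_poly (\<lambda>z. c)"
  using trig_poly_powi[of c 0] by simp

lemma trig_poly_add:
  assumes "trig_poly p" "trig_poly q"
  shows "trig_poly (\<lambda>z. p z + q z)"
proof -
  obtain S a T b where *: "finite S" "\<And>z. z \<in> sphere 0 1 \<Longrightarrow> p z = (\<Sum>k\<in>S. a k * z powi k)"
      "finite T" "\<And>z. z \<in> sphere 0 1 \<Longrightarrow> q z = (\<Sum>k\<in>T. b k * z powi k)"
    using assms unfolding trig_poly_def by metis
  have "p z + q z = (\<Sum>k\<in>S \<union> T. ((if k \<in> S then a k else 0) + (if k \<in> T then b k else 0)) * z powi k)"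
    if "z \<in> sphere 0 1" for z
  proof -
    have "(\<Sum>k\<in>S \<union> T. (if k \<in> S then a k else 0) * z powi k) = (\<Sum>k\<in>S. a k * z powi k)"
      by (rule sum.mono_neutral_cong_right) (use *(1,3) in auto)
    moreover have "(\<Sum>k\<in>S \<union> T. (if k \<in> T then b k else 0) * z powi k) = (\<Sum>k\<in>T. b k * z powi k)"
      by (rule sum.mono_neutral_cong_right) (use *(1,3) in auto)
    ultimately show ?thesis
      using *(2,4)[OF that] by (simp only: distrib_right sum.distrib)
  qed
  then show ?thesis
    unfolding trig_poly_def using *(1,3)
    by (intro exI[of _ "S \<union> T"] exI[of _ "\<lambda>k. (if k \<in> S then a k else 0) + (if k \<in> T then b k else 0)"]) auto
qed

lemma trig_poly_sum: "(\<And>i. i \<in> I \<Longrightarrow> trig_poly (p i)) \<Longrightarrow> trig_poly (\<lambda>z. \<Sum>i\<in>I. p i z)"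
  by (induction I rule: infinite_finite_induct) (auto intro: trig_poly_const trig_poly_add)

lemma trig_poly_cong: "trig_poly p \<Longrightarrow> (\<And>z. z \<in> sphere 0 1 \<Longrightarrow> p z = q z) \<Longrightarrow> trig_poly q"
  unfolding trig_poly_def by metis

lemma trig_poly_mult:
  assumes "trig_poly p" "trig_poly q"
  shows "trig_poly (\<lambda>z. p z * q z)"
proof -
  obtain S a T b where *: "\<And>z. z \<in> sphere 0 1 \<Longrightarrow> p z = (\<Sum>k\<in>S. a k * z powi k)"
      "\<And>z. z \<in> sphere 0 1 \<Longrightarrow> q z = (\<Sum>k\<in>T. b k * z powi k)"
    using assms unfolding trig_poly_def by metis
  have "trig_poly (\<lambda>z. \<Sum>k\<in>S. \<Sum>l\<in>T. (a k * b l) * z powi (k + l))"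
    by (intro trig_poly_sum trig_poly_powi)
  then show ?thesis
  proof (rule trig_poly_cong)
    fix z :: complex assume z: "z \<in> sphere 0 1"
    then have "z \<noteq> 0" by auto
    then show "(\<Sum>k\<in>S. \<Sum>l\<in>T. (a k * b l) * z powi (k + l)) = p z * q z"
      unfolding *[OF z] sum_product by (simp add: power_int_add mult_ac)
  qed
qed

text \<open>Links Stone-Weierstrass, which supplies real polynomial functions on the plane, to the
  characters. Only the linear case has content: \<open>Re z\<close> and \<open>Im z\<close> are
  combinations of \<open>z\<close> and \<open>cnj z = inverse z\<close>.\<close>

lemma real_polynomial_function_trig_poly:
  assumes "real_polynomial_function p"
  shows "trig_poly (\<lambda>z. of_real (p z))"
  using assms
proof induction
  case (linear f)
  interpret bounded_linear f by fact
  \<comment> \<open>These are the coefficients of \<open>z\<close> and \<open>cnj z\<close> in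
    \<open>f z = Re z * f 1 + Im z * f \<i>\<close>.\<close>
  have "trig_poly (\<lambda>z. ((of_real (f 1) - \<i> * of_real (f \<i>)) / 2) * z powi 1 + ((of_real (f 1) + \<i> * of_real (f \<i>)) / 2) * z powi (-1))"
    by (intro trig_poly_add trig_poly_powi)
  then show ?case
  proof (rule trig_poly_cong)
    fix z :: complex assume "z \<in> sphere 0 1"
    then have "cmod z = 1" by simp
    then have "z * cnj z = 1"
      by (simp add: complex_norm_square[symmetric])
    then have inv: "inverse z = cnj z"
      by (rule inverse_unique)
    have "z = Re z *\<^sub>R 1 + Im z *\<^sub>R \<i>" by (simp add: complex_eq_iff)
    then have "f z = Re z * f 1 + Im z * f \<i>" by (metis add scaleR real_scaleR_def)
    then have "complex_of_real (f z) = of_real (f 1) * ((z + cnj z) / 2) + of_real (f \<i>) * (- (\<i> * (z - cnj z) / 2))"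
      unfolding complex_add_cnj complex_diff_cnj by (simp add: mult.commute)
    also have "\<dots> = ((of_real (f 1) - \<i> * of_real (f \<i>)) / 2) * z + ((of_real (f 1) + \<i> * of_real (f \<i>)) / 2) * cnj z"
      by (simp add: algebra_simps add_divide_distrib diff_divide_distrib)
    finally show "((of_real (f 1) - \<i> * of_real (f \<i>)) / 2) * z powi 1 + ((of_real (f 1) + \<i> * of_real (f \<i>)) / 2) * z powi (-1)
        = of_real (f z)"
      by (simp only: power_int_minus inv power_int_1_right)
  qed
qed (auto intro: trig_poly_const trig_poly_add trig_poly_mult)

text \<open>A function annihilating the characters annihilates products of trigonometric polynomials in the
  single variables, then by Stone-Weierstrass products of continuous functions, then indicators of
  closed boxes; these form a generator stable under intersections.\<close>

context
  fixes d :: nat and f :: "(nat \<Rightarrow> complex) \<Rightarrow> complex"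
  assumes f: "integrable (torus d) f"
    and zero: "\<And>\<alpha>. (LINT z|torus d. f z * character d \<alpha> z) = 0"
begin

private lemma annihilates_trig_polys:
  assumes "\<And>i. i \<in> {1..d} \<Longrightarrow> trig_poly (h i)"
  shows "(LINT z|torus d. f z * (\<Prod>i\<in>{1..d}. h i (z i))) = 0"
proof -
  have "\<forall>i\<in>{1..d}. \<exists>Sc. finite (fst Sc) \<and> (\<forall>z\<in>sphere 0 1. h i z = (\<Sum>k\<in>fst Sc. snd Sc k * z powi k))"
    using assms unfolding trig_poly_def by auto
  then obtain Sc where Sc: "\<And>i. i \<in> {1..d} \<Longrightarrow> finite (fst (Sc i))"
      "\<And>i z. i \<in> {1..d} \<Longrightarrow> z \<in> sphere 0 1 \<Longrightarrow> h i z = (\<Sum>k\<in>fst (Sc i). snd (Sc i) k * z powi k)"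
    by metis
  define S c where "S i = fst (Sc i)" and "c i = snd (Sc i)" for i
  have "(LINT z|torus d. f z * (\<Prod>i\<in>{1..d}. h i (z i)))
      = (LINT z|torus d. (\<Sum>\<alpha>\<in>PiE {1..d} S. (\<Prod>i\<in>{1..d}. c i (\<alpha> i)) * (f z * character d \<alpha> z)))"
  proof (rule Bochner_Integration.integral_cong[OF refl])
    fix z assume z: "z \<in> space (torus d)"
    have "(\<Prod>i\<in>{1..d}. h i (z i)) = (\<Prod>i\<in>{1..d}. \<Sum>k\<in>S i. c i k * z i powi k)"
      using z by (intro prod.cong refl) (simp add: Sc(2) S_def c_def norm_torus_component)
    \<comment> \<open>Distributing the product of sums, a choice of one exponent in each variable is
      a multi-index, and its term is a multiple of a character.\<close>
    also have "\<dots> = (\<Sum>\<alpha>\<in>PiE {1..d} S. \<Prod>i\<in>{1..d}. c i (\<alpha> i) * z i powi \<alpha> i)"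
      using Sc(1) by (intro prod_sum_PiE) (auto simp: S_def)
    finally show "f z * (\<Prod>i\<in>{1..d}. h i (z i)) = (\<Sum>\<alpha>\<in>PiE {1..d} S. (\<Prod>i\<in>{1..d}. c i (\<alpha> i)) * (f z * character d \<alpha> z))"
      by (simp add: prod.distrib character_def sum_distrib_left mult_ac)
  qed
  also have "\<dots> = (\<Sum>\<alpha>\<in>PiE {1..d} S. (\<Prod>i\<in>{1..d}. c i (\<alpha> i)) * (LINT z|torus d. f z * character d \<alpha> z))"
  proof -
    have "integrable (torus d) (\<lambda>z. f z * character d \<alpha> z)" for \<alpha>
    proof (rule Bochner_Integration.integrable_bound[OF f])
      have [measurable]: "f \<in> borel_measurable (torus d)" using f by auto
      show "(\<lambda>z. f z * character d \<alpha> z) \<in> borel_measurable (torus d)" by measurable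
    qed (auto simp: norm_mult norm_character)
    then show ?thesis by simp
  qed
  finally show ?thesis by (simp add: zero)
qed

text \<open>Dominated convergence, with \<open>cmod (f z) * (\<Prod>i\<in>{1..d}. B i)\<close> as
  majorant. It serves both passages, from polynomials to continuous functions and from these to
  indicators of closed boxes.\<close>

private lemma annihilates_limit:
  assumes h: "\<And>n i. i \<in> {1..d} \<Longrightarrow> h n i \<in> borel_measurable borel"
    and g: "\<And>i. i \<in> {1..d} \<Longrightarrow> g i \<in> borel_measurable borel"
    and B: "\<And>n i z. i \<in> {1..d} \<Longrightarrow> z \<in> sphere 0 1 \<Longrightarrow> cmod (h n i z) \<le> B i"
    and lim: "\<And>i z. i \<in> {1..d} \<Longrightarrow> z \<in> sphere 0 1 \<Longrightarrow> (\<lambda>n. h n i z) \<longlonglongrightarrow> g i z"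
    and 0: "\<And>n. (LINT z|torus d. f z * (\<Prod>i\<in>{1..d}. h n i (z i))) = 0"
  shows "(LINT z|torus d. f z * (\<Prod>i\<in>{1..d}. g i (z i))) = 0"
proof -
  have [measurable]: "f \<in> borel_measurable (torus d)" using f by auto
  have prod_meas [measurable]: "(\<lambda>z. \<Prod>i\<in>{1..d}. u i (z i)) \<in> borel_measurable (torus d)"
    if "\<And>i. i \<in> {1..d} \<Longrightarrow> u i \<in> borel_measurable borel" for u :: "nat \<Rightarrow> complex \<Rightarrow> complex"
    using that by (intro borel_measurable_prod measurable_compose[OF torus_component_measurable]) auto
  have "(\<lambda>n. LINT z|torus d. f z * (\<Prod>i\<in>{1..d}. h n i (z i))) \<longlonglongrightarrow> (LINT z|torus d. f z * (\<Prod>i\<in>{1..d}. g i (z i)))"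
  proof (rule integral_dominated_convergence[where w = "\<lambda>z. cmod (f z) * (\<Prod>i\<in>{1..d}. B i)"])
    show "(\<lambda>z. f z * (\<Prod>i\<in>{1..d}. g i (z i))) \<in> borel_measurable (torus d)"
      using prod_meas[of g] g by measurable
    show "(\<lambda>z. f z * (\<Prod>i\<in>{1..d}. h n i (z i))) \<in> borel_measurable (torus d)" for n
      using prod_meas[of "h n"] h by measurable
    show "integrable (torus d) (\<lambda>z. cmod (f z) * (\<Prod>i\<in>{1..d}. B i))"
      using f by auto
    show "AE z in torus d. (\<lambda>n. f z * (\<Prod>i\<in>{1..d}. h n i (z i))) \<longlonglongrightarrow> f z * (\<Prod>i\<in>{1..d}. g i (z i))"
      by (intro AE_I2 tendsto_mult tendsto_const tendsto_prod lim) (auto simp: norm_torus_component)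
    show "AE z in torus d. norm (f z * (\<Prod>i\<in>{1..d}. h n i (z i))) \<le> cmod (f z) * (\<Prod>i\<in>{1..d}. B i)" for n
      unfolding norm_mult prod_norm[symmetric]
      by (intro AE_I2 mult_left_mono prod_mono conjI B) (auto simp: norm_torus_component)
  qed
  then show ?thesis
    unfolding 0 by (simp add: LIMSEQ_const_iff)
qed

private lemma annihilates_continuous:
  fixes h :: "nat \<Rightarrow> complex \<Rightarrow> real"
  assumes h: "\<And>i. i \<in> {1..d} \<Longrightarrow> continuous_on UNIV (h i)"
  shows "(LINT z|torus d. f z * (\<Prod>i\<in>{1..d}. of_real (h i (z i)))) = 0"
proof -
  have "\<exists>p. real_polynomial_function p \<and> (\<forall>z\<in>sphere 0 1. \<bar>h i z - p z\<bar> < 1 / Suc n)"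
    if "i \<in> {1..d}" for i n
    using Stone_Weierstrass_real_polynomial_function[of "sphere 0 1" "h i" "1 / Suc n"]
      continuous_on_subset[OF h[OF that]] by (metis compact_sphere top_greatest of_nat_0_less_iff zero_less_Suc zero_less_divide_1_iff)
  then have "\<forall>n. \<forall>i\<in>{1..d}. \<exists>p. real_polynomial_function p \<and> (\<forall>z\<in>sphere 0 1. \<bar>h i z - p z\<bar> < 1 / Suc n)"
    by blast
  then obtain p where "\<forall>n. \<forall>i\<in>{1..d}. real_polynomial_function (p n i) \<and>
      (\<forall>z\<in>sphere 0 1. \<bar>h i z - p n i z\<bar> < 1 / Suc n)"
    unfolding bchoice_iff choice_iff by blast
  then have p: "\<And>i n. i \<in> {1..d} \<Longrightarrow> real_polynomial_function (p n i)"
      "\<And>i n z. i \<in> {1..d} \<Longrightarrow> z \<in> sphere 0 1 \<Longrightarrow> \<bar>h i z - p n i z\<bar> < 1 / Suc n"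
    by blast+
  have "\<exists>K. \<forall>z\<in>sphere 0 1. \<bar>h i z\<bar> \<le> K" if "i \<in> {1..d}" for i
    using compact_imp_bounded[OF compact_continuous_image[OF continuous_on_subset[OF h[OF that]] compact_sphere[of 0 1]]]
    by (force simp: bounded_iff)
  then obtain K where K: "\<And>i z. i \<in> {1..d} \<Longrightarrow> z \<in> sphere 0 1 \<Longrightarrow> \<bar>h i z\<bar> \<le> K i"
    by metis
  show ?thesis
  \<comment> \<open>The approximation error is at most 1, whence the bound \<open>K i + 1\<close>,
    uniform in \<open>n\<close>.\<close>
  proof (rule annihilates_limit[where h = "\<lambda>n i z. of_real (p n i z)" and B = "\<lambda>i. K i + 1" and g = "\<lambda>i z. of_real (h i z)"])
    fix n i assume i: "i \<in> {1..d}"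
    have "p n i \<in> borel_measurable borel" "h i \<in> borel_measurable borel"
      using p(1)[OF i] h[OF i] by (auto intro!: borel_measurable_continuous_onI continuous_on_polymonial_function simp: real_polynomial_function_eq o_def)
    then show "(\<lambda>z. complex_of_real (p n i z)) \<in> borel_measurable borel"
      "(\<lambda>z. complex_of_real (h i z)) \<in> borel_measurable borel" by measurable
    fix z :: complex assume z: "z \<in> sphere 0 1"
    have "1 / real (Suc n) \<le> 1" by simp
    then show "cmod (of_real (p n i z)) \<le> K i + 1"
      using p(2)[OF i z, of n] K[OF i z] unfolding norm_of_real by linarith
    have "(\<lambda>n. h i z - p n i z) \<longlonglongrightarrow> 0"
    proof (rule Lim_null_comparison[where g = "\<lambda>n. 1 / real (Suc n)"])
      show "\<forall>\<^sub>F n in sequentially. norm (h i z - p n i z) \<le> 1 / real (Suc n)"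
        using p(2)[OF i z] by (intro always_eventually allI) (auto intro: less_imp_le)
      show "(\<lambda>n. 1 / real (Suc n)) \<longlonglongrightarrow> 0" using LIMSEQ_inverse_real_of_nat by (simp add: inverse_eq_divide)
    qed
    then have "(\<lambda>n. h i z - (h i z - p n i z)) \<longlonglongrightarrow> h i z - 0"
      by (intro tendsto_intros)
    then show "(\<lambda>n. complex_of_real (p n i z)) \<longlonglongrightarrow> complex_of_real (h i z)"
      by (intro tendsto_of_real) simp
  qed (intro annihilates_trig_polys real_polynomial_function_trig_poly p)
qed

private lemma annihilates_closed_box:
  assumes C: "\<And>i. i \<in> {1..d} \<Longrightarrow> closed (C i)"
  shows "(LINT z|torus d. f z * (\<Prod>i\<in>{1..d}. indicator (C i) (z i))) = 0"
proof (cases "\<exists>i\<in>{1..d}. C i = {}")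
  \<comment> \<open>Treated apart because \<open>infdist\<close> to the empty set is 0, so that the
    functions \<open>h\<close> below would be constantly 1.\<close>
  case True
  then have "(\<Prod>i\<in>{1..d}. indicator (C i) (z i) :: complex) = 0" for z
    by (intro prod_zero) (auto intro!: bexI)
  then show ?thesis by (simp only: mult_zero_right Bochner_Integration.integral_zero)
next
  case False
  \<comment> \<open>Tent functions: equal to 1 on \<open>C i\<close> and zero from distance
    \<open>1 / n\<close> on. Points off the closed set \<open>C i\<close> have positive distance to
    it, so the tents tend to the indicator.\<close>
  define h where "h n i z = max 0 (1 - real n * infdist z (C i))" for n i and z :: complex
  have cont: "continuous_on UNIV (h n i)" for n i
    unfolding h_def[abs_def] by (intro continuous_intros)
  show ?thesis
  proof (rule annihilates_limit[where h = "\<lambda>n i z. of_real (h n i z)" and B = "\<lambda>i. 1"])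
    fix n i assume i: "i \<in> {1..d}"
    have [measurable]: "h n i \<in> borel_measurable borel" "C i \<in> sets borel"
      using C[OF i] by (auto intro!: borel_measurable_continuous_onI cont)
    show "(\<lambda>z. complex_of_real (h n i z)) \<in> borel_measurable borel"
      "indicator (C i) \<in> borel_measurable borel" by measurable
    fix z :: complex assume z: "z \<in> sphere 0 1"
    show "cmod (of_real (h n i z)) \<le> 1"
      by (auto simp: h_def infdist_nonneg)
    show "(\<lambda>n. complex_of_real (h n i z)) \<longlonglongrightarrow> indicator (C i) z"
    proof (cases "z \<in> C i")
      case True
      then show ?thesis by (simp add: h_def)
    next
      case notin: False
      then have pos: "infdist z (C i) > 0"
        using infdist_pos_not_in_closed[OF C[OF i]] False i by auto
      obtain N :: nat where N: "1 / infdist z (C i) < real N" using reals_Archimedean2 by blast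
      have "h n i z = 0" if "N \<le> n" for n
      proof -
        have "1 / infdist z (C i) \<le> real n" using N that by linarith
        then have "1 \<le> real n * infdist z (C i)" using pos by (simp add: field_simps)
        then show ?thesis by (simp add: h_def)
      qed
      then have "\<forall>\<^sub>F n in sequentially. complex_of_real (h n i z) = 0"
        using eventually_sequentially by auto
      then show ?thesis using notin by (simp add: tendsto_eventually)
    qed
  qed (intro annihilates_continuous cont)
qed

private lemma annihilates_measurable:
  assumes "A \<in> sets (torus d)"
  shows "(LINT z:A|torus d. f z) = 0"
proof -
  define E :: "complex set set" where "E = {C. closed C \<and> C \<subseteq> sphere 0 1}"
  \<comment> \<open>The closed boxes, in the shape that \<open>sets_PiM_sigma\<close> expects when
    \<open>{1..d}\<close> is taken as a single block.\<close>
  define P where "P = {{z\<in>{1..d} \<rightarrow>\<^sub>E sphere 0 1. \<forall>i\<in>j. z i \<in> C i} |C j. j \<in> {{1..d}} \<and> C \<in> Pi j (\<lambda>_. E)}"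
  have "sets circle = sets (restrict_space borel (sphere 0 1))"
    by (simp add: circle_def)
  also have "\<dots> = (\<inter>) (sphere 0 1) ` sigma_sets UNIV (Collect closed)"
    by (simp add: sets_restrict_space borel_eq_closed)
  also have "\<dots> = sigma_sets (sphere 0 1) ((\<inter>) (sphere 0 1) ` Collect closed)"
    by (rule sigma_sets_Int) (auto intro: sigma_sets.Basic)
  also have "(\<inter>) (sphere 0 1) ` Collect closed = E"
    unfolding E_def by (auto intro!: image_eqI[where f = "(\<inter>) (sphere 0 1)"] closed_Int)
  finally have "sets circle = sets (sigma (sphere 0 1) E)"
    by (subst sets_measure_of) (auto simp: E_def)
  then have "sets (torus d) = sets (\<Pi>\<^sub>M i\<in>{1..d}. sigma (sphere 0 1) E)"
    unfolding torus_def by (intro sets_PiM_cong) auto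
  also have "\<dots> = sets (sigma ({1..d} \<rightarrow>\<^sub>E sphere 0 1) P)"
    unfolding P_def
  proof (rule sets_PiM_sigma)
    show "\<exists>S\<subseteq>E. countable S \<and> sphere 0 1 = \<Union>S"
      by (rule exI[of _ "{sphere 0 1}"]) (auto simp: E_def)
  qed (auto simp: E_def)
  also have "\<dots> = sigma_sets ({1..d} \<rightarrow>\<^sub>E sphere 0 1) P"
    by (intro sets_measure_of) (auto simp: P_def)
  finally have sets: "sets (torus d) = sigma_sets (space (torus d)) P"
    by (simp add: space_torus)
  have int: "set_integrable (torus d) A f" if "A \<in> sets (torus d)" for A
    using integrable_mult_indicator[OF that f] by (simp add: set_integrable_def)
  have stable: "Int_stable P"
  proof (rule Int_stableI)
    fix a b assume "a \<in> P" "b \<in> P"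
    then obtain C D where "C \<in> {1..d} \<rightarrow> E" "D \<in> {1..d} \<rightarrow> E"
      "a = {z\<in>{1..d} \<rightarrow>\<^sub>E sphere 0 1. \<forall>i\<in>{1..d}. z i \<in> C i}" "b = {z\<in>{1..d} \<rightarrow>\<^sub>E sphere 0 1. \<forall>i\<in>{1..d}. z i \<in> D i}"
      unfolding P_def by auto
    then have "a \<inter> b = {z\<in>{1..d} \<rightarrow>\<^sub>E sphere 0 1. \<forall>i\<in>{1..d}. z i \<in> C i \<inter> D i}" "(\<lambda>i. C i \<inter> D i) \<in> {1..d} \<rightarrow> E"
      by (auto simp: E_def Pi_iff)
    then show "a \<inter> b \<in> P" unfolding P_def
      by (intro CollectI exI[of _ "\<lambda>i. C i \<inter> D i"] exI[of _ "{1..d}"]) simp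
  qed
  have A: "A \<in> sigma_sets (space (torus d)) P" using assms sets by simp
  \<comment> \<open>The character with exponent 0 is constantly 1; the integral over the whole torus
    is what the complement step below relies on.\<close>
  have total: "(LINT z|torus d. f z) = 0" using zero[of 0] by simp
  have "P \<subseteq> Pow (space (torus d))" by (auto simp: P_def space_torus)
  from stable this A show ?thesis
  proof (induction rule: sigma_sets_induct_disjoint)
    case (basic a)
    then obtain C where C: "C \<in> {1..d} \<rightarrow> E" "a = {z\<in>{1..d} \<rightarrow>\<^sub>E sphere 0 1. \<forall>i\<in>{1..d}. z i \<in> C i}"
      unfolding P_def by auto
    have "(LINT z:a|torus d. f z) = (LINT z|torus d. f z * (\<Prod>i\<in>{1..d}. indicator (C i) (z i)))"
      unfolding set_lebesgue_integral_def
    proof (rule Bochner_Integration.integral_cong[OF refl])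
      fix z assume "z \<in> space (torus d)"
      then show "indicator a z *\<^sub>R f z = f z * (\<Prod>i\<in>{1..d}. indicator (C i) (z i))"
        unfolding C(2) space_torus by (auto simp: indicator_def)
    qed
    also have "\<dots> = 0"
      using C(1) by (intro annihilates_closed_box) (auto simp: E_def)
    finally show ?case .
  next
    case empty
    show ?case by (simp add: set_lebesgue_integral_def)
  next
    case (compl a)
    then have a: "a \<in> sets (torus d)" by (simp add: sets)
    have "(LINT z:space (torus d) - a|torus d. f z) + (LINT z:a|torus d. f z) = (LINT z:(space (torus d) - a) \<union> a|torus d. f z)"
      using a by (intro set_integral_Un[symmetric] int) auto
    also have "(space (torus d) - a) \<union> a = space (torus d)" using sets.sets_into_space[OF a] by auto
    finally show ?case
      using total compl by (simp add: set_integral_space[OF f])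
  next
    case (union a)
    then have a: "a i \<in> sets (torus d)" for i by (auto simp: sets)
    have "(LINT z:(\<Union>i. a i)|torus d. f z) = (\<Sum>i. LINT z:a i|torus d. f z)"
      using a union(1) by (intro lebesgue_integral_countable_add int) (auto simp: disjoint_family_on_def)
    then show ?case using union by simp
  qed
qed

text \<open>A real function whose integrals over measurable sets all vanish is almost everywhere
  nonpositive, as seen on the set where it is positive. This applies to \<open>Re (f z)\<close>,
  \<open>Im (f z)\<close> and their negatives.\<close>

lemma AE_zero_if_annihilates_characters: "AE z in torus d. f z = 0"
proof -
  have real: "AE z in torus d. g z \<le> 0"
    if g: "integrable (torus d) g" and g0: "\<And>A. A \<in> sets (torus d) \<Longrightarrow> (LINT z:A|torus d. g z) = 0"
    for g :: "(nat \<Rightarrow> complex) \<Rightarrow> real"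
  proof -
    have [measurable]: "g \<in> borel_measurable (torus d)" using g by auto
    define A where "A = {z \<in> space (torus d). 0 < g z}"
    have A: "A \<in> sets (torus d)" unfolding A_def by measurable
    have "(LINT z|torus d. indicator A z *\<^sub>R g z) = 0"
      using g0[OF A] by (simp add: set_lebesgue_integral_def)
    then have "AE z in torus d. indicator A z *\<^sub>R g z = 0"
      using integral_nonneg_eq_0_iff_AE[OF integrable_mult_indicator[OF A g]]
      by (auto simp: A_def indicator_def)
    then show ?thesis
      using AE_space by eventually_elim (auto simp: A_def indicator_def split: if_splits)
  qed
  have int: "integrable (torus d) (\<lambda>z. indicator A z *\<^sub>R f z)" if "A \<in> sets (torus d)" for A
    using integrable_mult_indicator[OF that f] .
  have Re: "(LINT z:A|torus d. Re (f z)) = 0" and Im: "(LINT z:A|torus d. Im (f z)) = 0" if A: "A \<in> sets (torus d)" for A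
    using integral_Re[OF int[OF A]] integral_Im[OF int[OF A]] annihilates_measurable[OF A]
    by (simp_all add: set_lebesgue_integral_def)
  have "AE z in torus d. Re (f z) \<le> 0" "AE z in torus d. - Re (f z) \<le> 0"
    "AE z in torus d. Im (f z) \<le> 0" "AE z in torus d. - Im (f z) \<le> 0"
    using f Re Im by (intro real; simp add: set_lebesgue_integral_def)+
  then show ?thesis
    by eventually_elim (auto simp: complex_eq_iff)
qed

end


section \<open>Fourier series\<close>

text \<open>The multi-indices supported in \<^term>\<open>{1..d}\<close> label the characters without repetition.\<close>

definition indices :: "nat \<Rightarrow> (nat \<Rightarrow> int) set" where
  "indices d = {\<alpha>. \<forall>i. i \<notin> {1..d} \<longrightarrow> \<alpha> i = 0}"

text \<open>Finite boxes of exponents. Those with \<open>m = 0\<close> carry analytic polynomials,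
  those with \<open>n = 0\<close> their conjugates, and the symmetric ones exhaust
  \<open>indices d\<close> when \<open>A\<close> is \<open>{1..d}\<close>.\<close>

definition multiindices :: "nat set \<Rightarrow> int \<Rightarrow> int \<Rightarrow> (nat \<Rightarrow> int) set" where
  "multiindices A m n = {\<alpha>. (\<forall>i\<in>A. \<alpha> i \<in> {m..n}) \<and> (\<forall>i. i \<notin> A \<longrightarrow> \<alpha> i = 0)}"

lemma finite_multiindices [simp]: "finite A \<Longrightarrow> finite (multiindices A m n)"
  using finite_set_of_finite_funs[of A "{m..n}" "0 :: int"]
  by (rule finite_subset[rotated]) (auto simp: multiindices_def)

lemma multiindices_subset_indices: "A \<subseteq> {1..d} \<Longrightarrow> multiindices A m n \<subseteq> indices d"
  by (auto simp: multiindices_def indices_def)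

lemma multiindices_mono: "m' \<le> m \<Longrightarrow> n \<le> n' \<Longrightarrow> multiindices A m n \<subseteq> multiindices A m' n'"
  by (fastforce simp: multiindices_def)

text \<open>\<open>H2\<close> speaks of all multi-indices, Fourier series run over
  \<open>indices d\<close>; together with \<open>fourier_coeff_cong\<close> this passes from the
  former to the latter.\<close>

lemma restrict_index:
  obtains \<alpha>' where "\<alpha>' \<in> indices d" "\<And>i. i \<in> {1..d} \<Longrightarrow> \<alpha>' i = \<alpha> i"
  by (rule that[of "\<lambda>i. if i \<in> {1..d} then \<alpha> i else 0"]) (auto simp: indices_def)

lemma fourier_coeff_character_indices:
  assumes "\<alpha> \<in> indices d" "\<beta> \<in> indices d"
  shows "fourier_coeff d (character d \<alpha>) \<beta> = (if \<alpha> = \<beta> then 1 else 0)"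
proof -
  have "(\<forall>i\<in>{1..d}. \<alpha> i = \<beta> i) \<longleftrightarrow> \<alpha> = \<beta>"
    using assms unfolding indices_def fun_eq_iff mem_Collect_eq by metis
  then show ?thesis by (simp only: fourier_coeff_character)
qed

lemma index_in_multiindices:
  assumes "\<alpha> \<in> indices d"
  obtains n :: nat where "\<alpha> \<in> multiindices {1..d} (- int n) (int n)"
proof
  have "\<bar>\<alpha> i\<bar> \<le> (\<Sum>j\<in>{1..d}. \<bar>\<alpha> j\<bar>)" if "i \<in> {1..d}" for i
    using that by (intro member_le_sum) auto
  then show "\<alpha> \<in> multiindices {1..d} (- int (nat (\<Sum>j\<in>{1..d}. \<bar>\<alpha> j\<bar>))) (int (nat (\<Sum>j\<in>{1..d}. \<bar>\<alpha> j\<bar>)))"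
    using assms by (fastforce simp: multiindices_def indices_def abs_le_iff sum_nonneg)
qed

section \<open>Finite trigonometric sums and Bessel's inequality\<close>

definition trig_sum :: "nat \<Rightarrow> (nat \<Rightarrow> int) set \<Rightarrow> ((nat \<Rightarrow> int) \<Rightarrow> complex) \<Rightarrow> (nat \<Rightarrow> complex) \<Rightarrow> complex" where
  "trig_sum d S c z = (\<Sum>\<alpha>\<in>S. c \<alpha> * character d \<alpha> z)"

lemma trig_sum_L2: "trig_sum d S c \<in> L2 d"
  unfolding trig_sum_def[abs_def] by (intro L2_sum L2_cmult character_L2)

lemma fourier_coeff_add: "f \<in> L2 d \<Longrightarrow> g \<in> L2 d \<Longrightarrow>
    fourier_coeff d (\<lambda>z. f z + g z) \<alpha> = fourier_coeff d f \<alpha> + fourier_coeff d g \<alpha>"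
  unfolding fourier_coeff_def by (intro L2_inner_add character_L2)

lemma fourier_coeff_diff: "f \<in> L2 d \<Longrightarrow> g \<in> L2 d \<Longrightarrow>
    fourier_coeff d (\<lambda>z. f z - g z) \<alpha> = fourier_coeff d f \<alpha> - fourier_coeff d g \<alpha>"
  unfolding fourier_coeff_def by (intro L2_inner_diff character_L2)

lemma fourier_coeff_cmult: "fourier_coeff d (\<lambda>z. c * f z) \<alpha> = c * fourier_coeff d f \<alpha>"
  unfolding fourier_coeff_def by (rule L2_inner_cmult)

lemma fourier_coeff_trig_sum:
  assumes "finite S" "S \<subseteq> indices d" "\<beta> \<in> indices d"
  shows "fourier_coeff d (trig_sum d S c) \<beta> = (if \<beta> \<in> S then c \<beta> else 0)"
proof -
  have "fourier_coeff d (trig_sum d S c) \<beta> = (\<Sum>\<alpha>\<in>S. c \<alpha> * fourier_coeff d (character d \<alpha>) \<beta>)"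
    unfolding fourier_coeff_def trig_sum_def[abs_def]
    by (subst L2_inner_sum) (auto simp: L2_inner_cmult intro: L2_cmult character_L2)
  also have "\<dots> = (\<Sum>\<alpha>\<in>S. if \<alpha> = \<beta> then c \<beta> else 0)"
    using assms by (intro sum.cong refl) (auto simp: fourier_coeff_character_indices)
  finally show ?thesis using assms(1) by simp
qed

lemma L2_inner_trig_sum:
  assumes "f \<in> L2 d"
  shows "L2_inner d f (trig_sum d S c) = (\<Sum>\<alpha>\<in>S. cnj (c \<alpha>) * fourier_coeff d f \<alpha>)"
proof -
  have "L2_inner d f (trig_sum d S c) = cnj (L2_inner d (trig_sum d S c) f)"
    by (simp add: L2_inner_cnj)
  also have "L2_inner d (trig_sum d S c) f = (\<Sum>\<alpha>\<in>S. c \<alpha> * L2_inner d (character d \<alpha>) f)"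
    unfolding trig_sum_def[abs_def]
    by (subst L2_inner_sum) (auto simp: L2_inner_cmult intro: L2_cmult character_L2 assms)
  finally show ?thesis by (simp add: L2_inner_cnj fourier_coeff_def)
qed

lemma L2_norm_trig_sum:
  assumes "finite S" "S \<subseteq> indices d"
  shows "(L2_norm d (trig_sum d S c))\<^sup>2 = (\<Sum>\<alpha>\<in>S. (cmod (c \<alpha>))\<^sup>2)"
proof -
  have "complex_of_real ((L2_norm d (trig_sum d S c))\<^sup>2) = L2_inner d (trig_sum d S c) (trig_sum d S c)"
    by (rule L2_inner_self[symmetric])
  also have "\<dots> = (\<Sum>\<alpha>\<in>S. cnj (c \<alpha>) * c \<alpha>)"
    using assms by (subst L2_inner_trig_sum[OF trig_sum_L2])
      (auto intro!: sum.cong simp: fourier_coeff_trig_sum subset_iff)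
  also have "\<dots> = of_real (\<Sum>\<alpha>\<in>S. (cmod (c \<alpha>))\<^sup>2)"
    unfolding of_real_sum by (intro sum.cong refl) (metis complex_norm_square mult.commute)
  finally show ?thesis by (simp only: of_real_eq_iff)
qed

text \<open>The remainder has no coefficients left on \<open>S\<close>, hence is orthogonal to the
  partial sum, and Pythagoras applies. The right-hand side yields Bessel's inequality and also
  serves as the exact error of approximation.\<close>

lemma L2_norm_minus_partial_sum:
  assumes f: "f \<in> L2 d" and S: "finite S" "S \<subseteq> indices d"
  shows "(L2_norm d (\<lambda>z. f z - trig_sum d S (fourier_coeff d f) z))\<^sup>2 =
    (L2_norm d f)\<^sup>2 - (\<Sum>\<alpha>\<in>S. (cmod (fourier_coeff d f \<alpha>))\<^sup>2)"
proof -
  let ?s = "trig_sum d S (fourier_coeff d f)"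
  have L2: "(\<lambda>z. f z - ?s z) \<in> L2 d" by (intro L2_diff f trig_sum_L2)
  have "L2_inner d (\<lambda>z. f z - ?s z) ?s = 0"
    unfolding L2_inner_trig_sum[OF L2] using S
    by (intro sum.neutral) (auto simp: fourier_coeff_diff f trig_sum_L2 fourier_coeff_trig_sum subset_iff)
  with L2_norm_add_square[OF L2 trig_sum_L2, of S "fourier_coeff d f"] show ?thesis
    by (simp add: L2_norm_trig_sum[OF S])
qed

lemma bessel_inequality:
  assumes "f \<in> L2 d" "finite S" "S \<subseteq> indices d"
  shows "(\<Sum>\<alpha>\<in>S. (cmod (fourier_coeff d f \<alpha>))\<^sup>2) \<le> (L2_norm d f)\<^sup>2"
  using L2_norm_minus_partial_sum[OF assms] by (metis diff_ge_0_iff_ge zero_le_power2)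

text \<open>The difference is integrable and its integral against every character vanishes, so
  \<open>AE_zero_if_annihilates_characters\<close> applies.\<close>

lemma L2_unique:
  assumes "f \<in> L2 d" "g \<in> L2 d"
    and eq: "\<And>\<alpha>. \<alpha> \<in> indices d \<Longrightarrow> fourier_coeff d f \<alpha> = fourier_coeff d g \<alpha>"
  shows "AE z in torus d. f z = g z"
proof -
  have L2: "(\<lambda>z. f z - g z) \<in> L2 d" by (intro L2_diff assms)
  have "integrable (torus d) (\<lambda>z. f z - g z)"
    using torus.norm_integral_le_square(1)[OF L2_measurable[OF L2] L2_integrable_square[OF L2]] .
  moreover have "(LINT z|torus d. (f z - g z) * character d \<alpha> z) = 0" for \<alpha>
  proof -
    obtain \<beta> where \<beta>: "\<beta> \<in> indices d" "\<And>i. i \<in> {1..d} \<Longrightarrow> \<beta> i = (- \<alpha>) i"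
      using restrict_index[of d "- \<alpha>"] by blast
    have "(LINT z|torus d. (f z - g z) * character d \<alpha> z) = fourier_coeff d (\<lambda>z. f z - g z) (- \<alpha>)"
      by (simp add: fourier_coeff_eq_integral)
    also have "\<dots> = fourier_coeff d (\<lambda>z. f z - g z) \<beta>"
      using \<beta>(2) by (intro fourier_coeff_cong) simp
    finally show ?thesis
      using eq[OF \<beta>(1)] by (simp add: fourier_coeff_diff assms)
  qed
  ultimately have "AE z in torus d. f z - g z = 0"
    by (rule AE_zero_if_annihilates_characters)
  then show ?thesis by eventually_elim simp
qed

section \<open>The Riesz-Fischer theorem and Parseval's identity\<close>

lemma L2_norm_cong_AE:
  assumes "f \<in> L2 d" "g \<in> L2 d" "AE z in torus d. f z = g z"
  shows "L2_norm d f = L2_norm d g"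
proof -
  note [measurable] = L2_measurable[OF assms(1)] L2_measurable[OF assms(2)]
  show ?thesis
    unfolding L2_norm_def using assms(3)
    by (intro arg_cong[where f = sqrt] integral_cong_AE) (measurable, auto)
qed

lemma fourier_coeff_cong_AE:
  assumes [measurable]: "f \<in> borel_measurable (torus d)" "g \<in> borel_measurable (torus d)"
    and "AE z in torus d. f z = g z"
  shows "fourier_coeff d f \<alpha> = fourier_coeff d g \<alpha>"
  unfolding fourier_coeff_eq_integral using assms(3)
  by (intro integral_cong_AE) (measurable, auto)

text \<open>A subsequence of the partial sums is Cauchy at a geometric rate, so a limit exists, and
  Bessel's inequality for a single index carries the coefficients over to it. The union of the sets
  \<open>S n\<close> may be a part of \<open>indices d\<close>, which is how projections are
  built.\<close>

lemma riesz_fischer: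
  assumes fin: "\<And>n. finite (S n)" and sub: "\<And>n. S n \<subseteq> indices d" and inc: "incseq S"
    and bound: "\<And>n. (\<Sum>\<alpha>\<in>S n. (cmod (c \<alpha>))\<^sup>2) \<le> B"
  obtains g where "g \<in> L2 d"
    and "\<And>\<alpha>. \<alpha> \<in> indices d \<Longrightarrow> fourier_coeff d g \<alpha> = (if \<alpha> \<in> (\<Union>n. S n) then c \<alpha> else 0)"
    and "(\<lambda>n. \<Sum>\<alpha>\<in>S n. (cmod (c \<alpha>))\<^sup>2) \<longlonglongrightarrow> (L2_norm d g)\<^sup>2"
proof -
  define a where "a n = (\<Sum>\<alpha>\<in>S n. (cmod (c \<alpha>))\<^sup>2)" for n
  have a_inc: "incseq a"
    unfolding a_def using fin incseqD[OF inc] by (intro incseq_SucI sum_mono2) auto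
  obtain L where lim: "a \<longlonglongrightarrow> L" and le: "\<And>n. a n \<le> L"
    using incseq_convergent[OF a_inc, of B] bound unfolding a_def by auto
  \<comment> \<open>The squared distance of two partial sums is a difference of values of
    \<open>a\<close>, so the tails \<open>L - a m\<close> control it.\<close>
  have "\<exists>N. \<forall>m\<ge>N. L - a m < (1 / 4) ^ n" for n
  proof -
    obtain N where "\<forall>m\<ge>N. norm (a m - L) < (1 / 4) ^ n" using LIMSEQ_D[OF lim, of "(1 / 4) ^ n"] by auto
    then have "\<forall>m\<ge>N. L - a m < (1 / 4) ^ n" by (auto simp: abs_less_iff)
    then show ?thesis ..
  qed
  then obtain N where N: "\<And>n m. N n \<le> m \<Longrightarrow> L - a m < (1 / 4) ^ n" by metis
  \<comment> \<open>The summand \<open>n\<close> makes \<open>S (k n)\<close> exhaust the union even if \<open>N\<close> is bounded.\<close>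
  define k where "k n = (\<Sum>i\<le>n. N i) + n" for n
  have k_mono: "k n \<le> k m" if "n \<le> m" for n m
    unfolding k_def using that by (intro add_mono sum_mono2) auto
  have k_N: "L - a (k n) \<le> (1 / 4) ^ n" for n
    using N[of n "k n"] member_le_sum[of n "{..n}" N] by (simp add: k_def)
  define s where "s n = trig_sum d (S (k n)) c" for n
  have s_L2: "s n \<in> L2 d" for n unfolding s_def by (rule trig_sum_L2)
  have s_diff: "(LINT z|torus d. (norm (s m z - s n z))\<^sup>2) \<le> (1 / 4) ^ n" if "n \<le> m" for m n
  proof -
    have sub': "S (k n) \<subseteq> S (k m)" using incseqD[OF inc k_mono[OF that]] .
    have "s m z - s n z = trig_sum d (S (k m) - S (k n)) c z" for z
      unfolding s_def trig_sum_def using fin sub' by (simp add: sum_diff)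
    then have "(LINT z|torus d. (norm (s m z - s n z))\<^sup>2) = (L2_norm d (trig_sum d (S (k m) - S (k n)) c))\<^sup>2"
      by (simp add: L2_norm_square)
    also have "\<dots> = (\<Sum>\<alpha>\<in>S (k m) - S (k n). (cmod (c \<alpha>))\<^sup>2)"
      using fin sub by (intro L2_norm_trig_sum) auto
    also have "\<dots> = a (k m) - a (k n)" unfolding a_def using fin sub' by (simp add: sum_diff)
    also have "\<dots> \<le> (1 / 4) ^ n" using k_N[of n] le[of "k m"] by linarith
    finally show ?thesis .
  qed
  obtain g where g: "g \<in> borel_measurable (torus d)"
    "\<And>n. integrable (torus d) (\<lambda>z. (norm (g z - s n z))\<^sup>2)"
    "\<And>n. (LINT z|torus d. (norm (g z - s n z))\<^sup>2) \<le> (1 / 4) ^ n"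
  proof (rule torus.complete_square_integrable[of s d])
    show "s n \<in> borel_measurable (torus d)" for n by (rule L2_measurable[OF s_L2])
    show "integrable (torus d) (\<lambda>z. (norm (s m z - s n z))\<^sup>2)" for m n
      by (rule L2_integrable_square[OF L2_diff[OF s_L2 s_L2]])
  qed (use s_diff in auto)
  note [measurable] = g(1) L2_measurable[OF s_L2]
  have diff_L2: "(\<lambda>z. g z - s n z) \<in> L2 d" for n
    using g(2) by (simp add: L2_def)
  have g_L2: "g \<in> L2 d"
    using L2_add[OF diff_L2[of 0] s_L2[of 0]] by simp
  have coeff: "fourier_coeff d g \<alpha> = (if \<alpha> \<in> (\<Union>n. S n) then c \<alpha> else 0)" if \<alpha>: "\<alpha> \<in> indices d" for \<alpha>
  proof -
    have bd: "norm (fourier_coeff d g \<alpha> - fourier_coeff d (s n) \<alpha>) \<le> (1 / 2) ^ n" for n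
    proof -
      have "(cmod (fourier_coeff d (\<lambda>z. g z - s n z) \<alpha>))\<^sup>2 \<le> (L2_norm d (\<lambda>z. g z - s n z))\<^sup>2"
        using bessel_inequality[OF diff_L2, of "{\<alpha>}" n] \<alpha> by simp
      then have "(norm (fourier_coeff d g \<alpha> - fourier_coeff d (s n) \<alpha>))\<^sup>2 \<le> (1 / 4) ^ n"
        using g(3)[of n] by (simp add: L2_norm_square fourier_coeff_diff g_L2 s_L2)
      also have "(1 / 4) ^ n = ((1 / 2 :: real) ^ n)\<^sup>2"
        by (simp add: power2_eq_square power_mult_distrib[symmetric])
      finally show ?thesis by (rule power2_le_imp_le) simp
    qed
    have ev: "\<forall>\<^sub>F n in sequentially. fourier_coeff d (s n) \<alpha> = (if \<alpha> \<in> (\<Union>n. S n) then c \<alpha> else 0)"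
    proof (cases "\<alpha> \<in> (\<Union>n. S n)")
      case True
      then obtain M where M: "\<alpha> \<in> S M" by auto
      have "\<alpha> \<in> S (k n)" if "M \<le> n" for n
        using M incseqD[OF inc, of M "k n"] that by (auto simp: k_def)
      then show ?thesis using True
        by (auto simp: s_def fourier_coeff_trig_sum fin sub \<alpha> eventually_sequentially)
    next
      case False
      then show ?thesis by (auto simp: s_def fourier_coeff_trig_sum fin sub \<alpha>)
    qed
    have "(\<lambda>n. (1 / 2 :: real) ^ n) \<longlonglongrightarrow> 0" by (intro LIMSEQ_power_zero) auto
    then have "(\<lambda>n. fourier_coeff d g \<alpha> - fourier_coeff d (s n) \<alpha>) \<longlonglongrightarrow> 0"
      by (rule Lim_null_comparison[rotated]) (use bd in auto)
    then have "(\<lambda>n. fourier_coeff d g \<alpha> - (fourier_coeff d g \<alpha> - fourier_coeff d (s n) \<alpha>)) \<longlonglongrightarrow> fourier_coeff d g \<alpha> - 0"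
      by (intro tendsto_intros)
    then have "(\<lambda>n. fourier_coeff d (s n) \<alpha>) \<longlonglongrightarrow> fourier_coeff d g \<alpha>"
      by simp
    moreover have "(\<lambda>n. fourier_coeff d (s n) \<alpha> ) \<longlonglongrightarrow> (if \<alpha> \<in> (\<Union>n. S n) then c \<alpha> else 0)"
      by (rule tendsto_eventually[OF ev])
    ultimately show ?thesis by (rule LIMSEQ_unique)
  qed
  have coeff_S: "fourier_coeff d g \<alpha> = c \<alpha>" if "\<alpha> \<in> S n" for \<alpha> n
    using that coeff[of \<alpha>] sub[of n] by (metis UN_I UNIV_I subsetD)
  have sum_S: "(\<Sum>\<alpha>\<in>S n. (cmod (fourier_coeff d g \<alpha>))\<^sup>2) = a n" for n
    unfolding a_def by (intro sum.cong refl) (simp add: coeff_S)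
  \<comment> \<open>Bessel gives this inequality; the converse holds because
    \<open>(L2_norm d g)\<^sup>2 - a (k n)\<close> is exactly the squared distance from
    \<open>g\<close> to \<open>s n\<close>.\<close>
  have "L \<le> (L2_norm d g)\<^sup>2"
    using bessel_inequality[OF g_L2 fin sub] unfolding sum_S
    by (intro LIMSEQ_le_const2[OF lim]) auto
  moreover have "(L2_norm d g)\<^sup>2 \<le> L"
  proof -
    have "(L2_norm d g)\<^sup>2 - L \<le> (1 / 4) ^ n" for n
    proof -
      have "s n = trig_sum d (S (k n)) (fourier_coeff d g)"
        unfolding s_def trig_sum_def by (intro ext sum.cong refl) (simp add: coeff_S)
      then have "(L2_norm d g)\<^sup>2 - a (k n) \<le> (1 / 4) ^ n"
        using L2_norm_minus_partial_sum[OF g_L2 fin sub, of "k n"] g(3)[of n]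
        by (simp add: sum_S L2_norm_square)
      then show ?thesis using le[of "k n"] by linarith
    qed
    moreover have "(\<lambda>n. (1 / 4 :: real) ^ n) \<longlonglongrightarrow> 0" by (intro LIMSEQ_power_zero) auto
    ultimately have "(L2_norm d g)\<^sup>2 - L \<le> 0" by (intro LIMSEQ_le_const) auto
    then show ?thesis by simp
  qed
  ultimately have "(\<lambda>n. \<Sum>\<alpha>\<in>S n. (cmod (c \<alpha>))\<^sup>2) \<longlonglongrightarrow> (L2_norm d g)\<^sup>2"
    using lim by (simp add: a_def[abs_def])
  with g_L2 coeff show ?thesis by (rule that)
qed

text \<open>\<open>riesz_fischer\<close> rebuilds from the coefficients of \<open>f\<close> a
  function with the same coefficients, and completeness of the characters (\<open>L2_unique\<close>)
  identifies it with \<open>f\<close> almost everywhere.\<close>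

lemma parseval:
  assumes f: "f \<in> L2 d"
    and fin: "\<And>n. finite (S n)" and sub: "\<And>n. S n \<subseteq> indices d" and inc: "incseq S"
    and supp: "\<And>\<alpha>. \<alpha> \<in> indices d \<Longrightarrow> \<alpha> \<notin> (\<Union>n. S n) \<Longrightarrow> fourier_coeff d f \<alpha> = 0"
  shows "(\<lambda>n. \<Sum>\<alpha>\<in>S n. (cmod (fourier_coeff d f \<alpha>))\<^sup>2) \<longlonglongrightarrow> (L2_norm d f)\<^sup>2"
proof -
  obtain g where g: "g \<in> L2 d"
    "\<And>\<alpha>. \<alpha> \<in> indices d \<Longrightarrow> fourier_coeff d g \<alpha> = (if \<alpha> \<in> (\<Union>n. S n) then fourier_coeff d f \<alpha> else 0)"
    "(\<lambda>n. \<Sum>\<alpha>\<in>S n. (cmod (fourier_coeff d f \<alpha>))\<^sup>2) \<longlonglongrightarrow> (L2_norm d g)\<^sup>2"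
    using riesz_fischer[OF fin sub inc bessel_inequality[OF f fin sub]] by metis
  have "AE z in torus d. f z = g z"
    using f g(1) by (rule L2_unique) (use g(2) supp in auto)
  then have "L2_norm d f = L2_norm d g" by (rule L2_norm_cong_AE[OF f g(1)])
  with g(3) show ?thesis by simp
qed

lemma Union_multiindices: "(\<Union>n. multiindices {1..d} (- int n) (int n)) = indices d"
proof (intro equalityI subsetI)
  fix \<alpha> assume "\<alpha> \<in> indices d"
  then obtain n :: nat where "\<alpha> \<in> multiindices {1..d} (- int n) (int n)"
    by (rule index_in_multiindices)
  then show "\<alpha> \<in> (\<Union>n. multiindices {1..d} (- int n) (int n))" by (rule UN_I[OF UNIV_I])
qed (use multiindices_subset_indices[of "{1..d}" d] in auto)

lemma parseval_boxes:
  assumes f: "f \<in> L2 d"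
  shows "(\<lambda>n. \<Sum>\<alpha>\<in>multiindices {1..d} (- int n) (int n). (cmod (fourier_coeff d f \<alpha>))\<^sup>2) \<longlonglongrightarrow> (L2_norm d f)\<^sup>2"
proof (rule parseval[OF f])
  show "incseq (\<lambda>n. multiindices {1..d} (- int n) (int n))"
    by (intro incseq_SucI multiindices_mono) auto
qed (auto simp only: Union_multiindices finite_multiindices finite_atLeastAtMost
    intro!: multiindices_subset_indices)

text \<open>Parseval for \<open>u\<close>, \<open>h\<close> and their sum makes the squared norms
  additive, so the real part of the inner product is 0. The same with \<open>\<i> * h\<close> in
  place of \<open>h\<close> settles the imaginary part.\<close>

lemma L2_inner_disjoint_spectra:
  assumes u: "u \<in> L2 d" and h: "h \<in> L2 d"
    and disj: "\<And>\<alpha>. \<alpha> \<in> indices d \<Longrightarrow> fourier_coeff d u \<alpha> = 0 \<or> fourier_coeff d h \<alpha> = 0"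
  shows "L2_inner d u h = 0"
proof -
  have Re: "Re (L2_inner d u v) = 0" if v: "v \<in> L2 d"
    and disj: "\<And>\<alpha>. \<alpha> \<in> indices d \<Longrightarrow> fourier_coeff d u \<alpha> = 0 \<or> fourier_coeff d v \<alpha> = 0" for v
  proof -
    let ?b = "\<lambda>n. multiindices {1..d} (- int n) (int n)"
    have "(\<lambda>n. (\<Sum>\<alpha>\<in>?b n. (cmod (fourier_coeff d u \<alpha>))\<^sup>2) + (\<Sum>\<alpha>\<in>?b n. (cmod (fourier_coeff d v \<alpha>))\<^sup>2))
        \<longlonglongrightarrow> (L2_norm d u)\<^sup>2 + (L2_norm d v)\<^sup>2"
      by (intro tendsto_add parseval_boxes u v)
    moreover have "(\<Sum>\<alpha>\<in>?b n. (cmod (fourier_coeff d u \<alpha>))\<^sup>2) + (\<Sum>\<alpha>\<in>?b n. (cmod (fourier_coeff d v \<alpha>))\<^sup>2)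
        = (\<Sum>\<alpha>\<in>?b n. (cmod (fourier_coeff d (\<lambda>z. u z + v z) \<alpha>))\<^sup>2)" for n
      unfolding sum.distrib[symmetric]
    proof (intro sum.cong refl)
      fix \<alpha> assume "\<alpha> \<in> ?b n"
      then have "\<alpha> \<in> indices d" using multiindices_subset_indices[of "{1..d}" d] by blast
      from disj[OF this] show "(cmod (fourier_coeff d u \<alpha>))\<^sup>2 + (cmod (fourier_coeff d v \<alpha>))\<^sup>2
        = (cmod (fourier_coeff d (\<lambda>z. u z + v z) \<alpha>))\<^sup>2"
        by (auto simp: fourier_coeff_add u v)
    qed
    ultimately have "(L2_norm d (\<lambda>z. u z + v z))\<^sup>2 = (L2_norm d u)\<^sup>2 + (L2_norm d v)\<^sup>2"
      using LIMSEQ_unique[OF parseval_boxes[OF L2_add[OF u v]]] by simp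
    then show ?thesis using L2_norm_add_square[OF u v] by simp
  qed
  have "L2_inner d u (\<lambda>z. \<i> * h z) = cnj (\<i> * L2_inner d h u)"
    by (metis L2_inner_cnj L2_inner_cmult)
  also have "\<dots> = - \<i> * L2_inner d u h" by (simp add: L2_inner_cnj)
  finally have "Im (L2_inner d u h) = Re (L2_inner d u (\<lambda>z. \<i> * h z))" by simp
  also have "\<dots> = 0"
    by (rule Re) (use disj in \<open>auto simp: fourier_coeff_cmult intro: L2_cmult h\<close>)
  finally show ?thesis using Re[OF h disj] by (simp add: complex_eq_iff)
qed


section \<open>The norm of a Hankel operator in terms of its matrix\<close>

lemma fourier_coeff_cnj: "fourier_coeff d (\<lambda>z. cnj (f z)) \<alpha> = cnj (fourier_coeff d f (- \<alpha>))"
proof -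
  have "fourier_coeff d (\<lambda>z. cnj (f z)) \<alpha> = (LINT z|torus d. cnj (f z * character d \<alpha> z))"
    by (simp only: fourier_coeff_def L2_inner_def complex_cnj_mult)
  also have "\<dots> = cnj (LINT z|torus d. f z * character d \<alpha> z)"
    by (rule Bochner_Integration.integral_cnj)
  finally show ?thesis by (simp add: fourier_coeff_eq_integral)
qed

text \<open>Conjugation negates frequencies, so membership turns into a condition on the support of
  the Fourier coefficients.\<close>

lemma conj_H2_iff:
  "h \<in> conj_H2 d \<longleftrightarrow> h \<in> L2 d \<and> (\<forall>\<alpha>. (\<exists>i\<in>{1..d}. 0 < \<alpha> i) \<longrightarrow> fourier_coeff d h \<alpha> = 0)"
proof
  assume "h \<in> conj_H2 d"
  then obtain f where "f \<in> H2 d" and h: "h = (\<lambda>z. cnj (f z))" by (auto simp: conj_H2_def)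
  then have f: "f \<in> L2 d" "\<And>\<alpha>. \<exists>i\<in>{1..d}. \<alpha> i < 0 \<Longrightarrow> fourier_coeff d f \<alpha> = 0"
    unfolding H2_def by blast+
  have "fourier_coeff d h \<alpha> = 0" if "\<exists>i\<in>{1..d}. 0 < \<alpha> i" for \<alpha>
    unfolding h fourier_coeff_cnj using f(2)[of "- \<alpha>"] that by simp
  then show "h \<in> L2 d \<and> (\<forall>\<alpha>. (\<exists>i\<in>{1..d}. 0 < \<alpha> i) \<longrightarrow> fourier_coeff d h \<alpha> = 0)"
    using L2_cnj[OF f(1)] by (simp add: h)
next
  assume h: "h \<in> L2 d \<and> (\<forall>\<alpha>. (\<exists>i\<in>{1..d}. 0 < \<alpha> i) \<longrightarrow> fourier_coeff d h \<alpha> = 0)"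
  have "fourier_coeff d (\<lambda>z. cnj (h z)) \<alpha> = 0" if "\<exists>i\<in>{1..d}. \<alpha> i < 0" for \<alpha>
    unfolding fourier_coeff_cnj using h that by simp
  then have "(\<lambda>z. cnj (h z)) \<in> H2 d"
    using h by (simp add: H2_def L2_cnj)
  then show "h \<in> conj_H2 d"
    unfolding conj_H2_def by (rule rev_image_eqI) simp
qed

lemma nonpos_if_multiindices: "\<alpha> \<in> multiindices A m 0 \<Longrightarrow> \<alpha> i \<le> 0"
  by (cases "i \<in> A") (auto simp: multiindices_def)

lemma nonneg_if_multiindices: "\<alpha> \<in> multiindices A 0 n \<Longrightarrow> 0 \<le> \<alpha> i"
  by (cases "i \<in> A") (auto simp: multiindices_def)

lemma indices_not_nonpos:
  assumes "\<alpha> \<in> indices d" "\<not> (\<forall>i. \<alpha> i \<le> 0)"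
  shows "\<exists>i\<in>{1..d}. 0 < \<alpha> i"
proof -
  obtain i where "0 < \<alpha> i" using assms(2) by (auto simp: not_le)
  moreover from this have "i \<in> {1..d}" using assms(1) unfolding indices_def by force
  ultimately show ?thesis by blast
qed

lemma Union_nonpos_multiindices:
  "(\<Union>n. multiindices {1..d} (- int n) 0) = {\<alpha> \<in> indices d. \<forall>i. \<alpha> i \<le> 0}"
proof (intro equalityI subsetI)
  fix \<alpha> assume \<alpha>: "\<alpha> \<in> {\<alpha> \<in> indices d. \<forall>i. \<alpha> i \<le> 0}"
  then obtain n :: nat where "\<alpha> \<in> multiindices {1..d} (- int n) (int n)"
    using index_in_multiindices[of \<alpha> d] by blast
  with \<alpha> have "\<alpha> \<in> multiindices {1..d} (- int n) 0" by (auto simp: multiindices_def)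
  then show "\<alpha> \<in> (\<Union>n. multiindices {1..d} (- int n) 0)" by (rule UN_I[OF UNIV_I])
next
  fix \<alpha> assume "\<alpha> \<in> (\<Union>n. multiindices {1..d} (- int n) 0)"
  then obtain n where "\<alpha> \<in> multiindices {1..d} (- int n) 0" by blast
  then show "\<alpha> \<in> {\<alpha> \<in> indices d. \<forall>i. \<alpha> i \<le> 0}"
    using nonpos_if_multiindices multiindices_subset_indices[of "{1..d}" d] by blast
qed

lemma incseq_nonpos_multiindices: "incseq (\<lambda>n. multiindices {1..d} (- int n) 0)"
  by (intro incseq_SucI multiindices_mono) auto

text \<open>Gives content to the choice in \<open>conj_proj\<close>. The witness keeps the
  coefficients of \<open>F\<close> at nonpositive frequencies and drops the others; the remainder
  then shares no frequency with any element of \<open>conj_H2 d\<close>.\<close>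

lemma conj_proj_exists:
  assumes F: "F \<in> L2 d"
  shows "\<exists>g. g \<in> conj_H2 d \<and> (\<forall>h\<in>conj_H2 d. L2_inner d (\<lambda>z. F z - g z) h = 0)"
proof -
  have sub: "multiindices {1..d} (- int n) 0 \<subseteq> indices d" for n
    by (rule multiindices_subset_indices) simp
  have fin: "finite (multiindices {1..d} (- int n) 0)" for n by simp
  obtain g where g: "g \<in> L2 d"
    "\<And>\<alpha>. \<alpha> \<in> indices d \<Longrightarrow> fourier_coeff d g \<alpha> = (if \<forall>i. \<alpha> i \<le> 0 then fourier_coeff d F \<alpha> else 0)"
  proof (rule riesz_fischer[OF fin sub incseq_nonpos_multiindices bessel_inequality[OF F fin sub]])
    fix g
    assume g: "g \<in> L2 d" "\<And>\<alpha>. \<alpha> \<in> indices d \<Longrightarrow> fourier_coeff d g \<alpha> =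
      (if \<alpha> \<in> (\<Union>n. multiindices {1..d} (- int n) 0) then fourier_coeff d F \<alpha> else 0)"
    show thesis
      by (rule that[OF g(1)]) (simp only: g(2) Union_nonpos_multiindices mem_Collect_eq simp_thms)
  qed
  have "g \<in> conj_H2 d"
    unfolding conj_H2_iff
  proof (intro conjI allI impI g(1))
    fix \<alpha> :: "nat \<Rightarrow> int" assume "\<exists>i\<in>{1..d}. 0 < \<alpha> i"
    then obtain i where i: "i \<in> {1..d}" "0 < \<alpha> i" by blast
    obtain \<beta> where \<beta>: "\<beta> \<in> indices d" "\<And>i. i \<in> {1..d} \<Longrightarrow> \<beta> i = \<alpha> i"
      using restrict_index[of d \<alpha>] by blast
    have "fourier_coeff d g \<alpha> = fourier_coeff d g \<beta>" by (rule fourier_coeff_cong) (simp add: \<beta>(2))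
    also have "\<dots> = 0" using i \<beta> g(2)[OF \<beta>(1)] by (metis not_less)
    finally show "fourier_coeff d g \<alpha> = 0" .
  qed
  moreover have "L2_inner d (\<lambda>z. F z - g z) h = 0" if h: "h \<in> conj_H2 d" for h
  proof (rule L2_inner_disjoint_spectra)
    show "(\<lambda>z. F z - g z) \<in> L2 d" by (intro L2_diff F g(1))
    show "h \<in> L2 d" using h by (simp add: conj_H2_iff)
    fix \<alpha> assume \<alpha>: "\<alpha> \<in> indices d"
    show "fourier_coeff d (\<lambda>z. F z - g z) \<alpha> = 0 \<or> fourier_coeff d h \<alpha> = 0"
    proof (cases "\<forall>i. \<alpha> i \<le> 0")
      case True
      then show ?thesis by (simp add: fourier_coeff_diff F g(1) g(2)[OF \<alpha>])
    next
      case False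
      with \<alpha> have "\<exists>i\<in>{1..d}. 0 < \<alpha> i" by (rule indices_not_nonpos)
      then show ?thesis using h by (simp add: conj_H2_iff)
    qed
  qed
  ultimately show ?thesis by blast
qed

text \<open>Whatever function the choice in \<open>conj_proj\<close> picks, testing against
  characters shows that it has the coefficients of \<open>F\<close> at nonpositive frequencies, and
  it has none elsewhere; so Parseval determines its norm. Frequencies are negated to let the sum run
  over \<beta> \<ge> 0.\<close>

lemma conj_proj_norm_limit:
  assumes F: "F \<in> L2 d"
  shows "(\<lambda>n. \<Sum>\<beta>\<in>multiindices {1..d} 0 (int n). (cmod (fourier_coeff d F (- \<beta>)))\<^sup>2)
    \<longlonglongrightarrow> (L2_norm d (conj_proj d F))\<^sup>2"
proof -
  define P where "P = conj_proj d F"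
  have "P \<in> conj_H2 d \<and> (\<forall>h\<in>conj_H2 d. L2_inner d (\<lambda>z. F z - P z) h = 0)"
    unfolding P_def conj_proj_def by (rule someI_ex[OF conj_proj_exists[OF F]])
  then have P: "P \<in> L2 d" and P0: "\<And>\<alpha>. \<exists>i\<in>{1..d}. 0 < \<alpha> i \<Longrightarrow> fourier_coeff d P \<alpha> = 0"
    and orth: "\<And>h. h \<in> conj_H2 d \<Longrightarrow> L2_inner d (\<lambda>z. F z - P z) h = 0"
    unfolding conj_H2_iff[of P] by blast+
  have coeff: "fourier_coeff d P \<alpha> = fourier_coeff d F \<alpha>" if "\<And>i. \<alpha> i \<le> 0" for \<alpha>
  proof -
    have "character d \<alpha> \<in> conj_H2 d"
      unfolding conj_H2_iff
    proof (intro conjI allI impI character_L2)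
      fix \<beta> :: "nat \<Rightarrow> int" assume "\<exists>i\<in>{1..d}. 0 < \<beta> i"
      then show "fourier_coeff d (character d \<alpha>) \<beta> = 0"
        unfolding fourier_coeff_character using that by (metis not_less)
    qed
    from orth[OF this] show ?thesis
      by (simp add: fourier_coeff_def L2_inner_diff F P character_L2)
  qed
  have "(\<lambda>n. \<Sum>\<alpha>\<in>multiindices {1..d} (- int n) 0. (cmod (fourier_coeff d P \<alpha>))\<^sup>2) \<longlonglongrightarrow> (L2_norm d P)\<^sup>2"
  proof (rule parseval[OF P _ _ incseq_nonpos_multiindices])
    fix \<alpha> assume \<alpha>: "\<alpha> \<in> indices d" "\<alpha> \<notin> (\<Union>n. multiindices {1..d} (- int n) 0)"
    then have "\<exists>i\<in>{1..d}. 0 < \<alpha> i"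
      unfolding Union_nonpos_multiindices by (intro indices_not_nonpos) auto
    then show "fourier_coeff d P \<alpha> = 0" by (rule P0)
  qed (simp_all add: multiindices_subset_indices)
  moreover have "(\<Sum>\<alpha>\<in>multiindices {1..d} (- int n) 0. (cmod (fourier_coeff d P \<alpha>))\<^sup>2)
      = (\<Sum>\<beta>\<in>multiindices {1..d} 0 (int n). (cmod (fourier_coeff d F (- \<beta>)))\<^sup>2)" for n
  proof (rule sum.reindex_bij_witness[of _ uminus uminus])
    fix \<alpha> assume "\<alpha> \<in> multiindices {1..d} (- int n) 0"
    then have "\<alpha> i \<le> 0" for i by (rule nonpos_if_multiindices)
    then show "(cmod (fourier_coeff d F (- (- \<alpha>))))\<^sup>2 = (cmod (fourier_coeff d P \<alpha>))\<^sup>2"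
      by (simp add: coeff)
  qed (auto simp: multiindices_def)
  ultimately show ?thesis unfolding P_def by simp
qed

section \<open>The matrix of a Hankel operator\<close>

lemma hankel_norm_limit:
  assumes \<phi>: "\<phi> \<in> L2 d" and S: "finite S"
  shows "(\<lambda>n. \<Sum>\<beta>\<in>multiindices {1..d} 0 (int n). (cmod (\<Sum>\<alpha>\<in>S. c \<alpha> * cnj (fourier_coeff d \<phi> (\<alpha> + \<beta>))))\<^sup>2)
    \<longlonglongrightarrow> (L2_norm d (hankel d \<phi> (trig_sum d S c)))\<^sup>2"
proof -
  let ?F = "\<lambda>z. cnj (\<phi> z) * trig_sum d S c z"
  have "cmod (trig_sum d S c z) \<le> (\<Sum>\<alpha>\<in>S. cmod (c \<alpha>))" if "z \<in> space (torus d)" for z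
    unfolding trig_sum_def by (intro order_trans[OF norm_sum] sum_mono) (simp add: norm_mult norm_character that)
  then have F: "?F \<in> L2 d"
    by (rule L2_bounded_mult[OF L2_cnj[OF \<phi>] L2_measurable[OF trig_sum_L2]])
  \<comment> \<open>Multiplication by \<open>character d \<alpha>\<close> shifts frequencies, so its
    contribution at \<open>- \<beta>\<close> comes from \<open>cnj (\<phi> z)\<close> at
    \<open>- (\<alpha> + \<beta>)\<close>: the Hankel pattern.\<close>
  have "fourier_coeff d ?F (- \<beta>) = (\<Sum>\<alpha>\<in>S. c \<alpha> * cnj (fourier_coeff d \<phi> (\<alpha> + \<beta>)))" for \<beta>
  proof -
    have coeff: "(LINT z|torus d. cnj (\<phi> z) * character d \<gamma> z) = cnj (fourier_coeff d \<phi> \<gamma>)" for \<gamma>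
      using fourier_coeff_cnj[of d \<phi> "- \<gamma>"] by (simp add: fourier_coeff_eq_integral)
    have int: "integrable (torus d) (\<lambda>z. cnj (\<phi> z) * character d \<alpha> z)" for \<alpha>
      by (intro L2_integrable_mult L2_cnj \<phi> character_L2)
    have "fourier_coeff d ?F (- \<beta>) = (LINT z|torus d. (\<Sum>\<alpha>\<in>S. c \<alpha> * (cnj (\<phi> z) * character d (\<alpha> + \<beta>) z)))"
      unfolding fourier_coeff_eq_integral trig_sum_def
      by (intro Bochner_Integration.integral_cong refl)
        (simp add: character_add sum_distrib_left sum_distrib_right mult_ac)
    also have "\<dots> = (\<Sum>\<alpha>\<in>S. c \<alpha> * (LINT z|torus d. cnj (\<phi> z) * character d (\<alpha> + \<beta>) z))"
      using int by simp
    finally show ?thesis by (simp only: coeff)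
  qed
  then show ?thesis
    using conj_proj_norm_limit[OF F] by (simp add: hankel_def)
qed

text \<open>The definition of \<open>analytic_polynomials\<close> admits distinct exponents that
  agree on \<open>{1..d}\<close> and hence name one character. Cutting them off outside
  \<open>{1..d}\<close> and collecting the coefficients removes the repetitions.\<close>

lemma analytic_polynomial_trig_sum:
  assumes "f \<in> analytic_polynomials d"
  obtains n :: nat and c where "f = trig_sum d (multiindices {1..d} 0 (int n)) c"
proof -
  obtain S a where S: "finite S" "\<And>\<alpha> i. \<alpha> \<in> S \<Longrightarrow> i \<in> {1..d} \<Longrightarrow> 0 \<le> \<alpha> i"
    and f: "f = (\<lambda>z. \<Sum>\<alpha>\<in>S. a \<alpha> * character d \<alpha> z)"
    using assms unfolding analytic_polynomials_def by blast
  define r :: "(nat \<Rightarrow> int) \<Rightarrow> nat \<Rightarrow> int" where "r \<alpha> i = (if i \<in> {1..d} then \<alpha> i else 0)" for \<alpha> i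
  have "finite ((\<lambda>(\<alpha>, i). nat (\<alpha> i)) ` (S \<times> {1..d}))" using S by simp
  then obtain n where n: "\<And>k. k \<in> (\<lambda>(\<alpha>, i). nat (\<alpha> i)) ` (S \<times> {1..d}) \<Longrightarrow> k \<le> n"
    unfolding finite_nat_set_iff_bounded_le by blast
  have "nat (\<alpha> i) \<le> n" if "\<alpha> \<in> S" "i \<in> {1..d}" for \<alpha> i
    using that by (intro n) (rule image_eqI[of _ _ "(\<alpha>, i)"], auto)
  then have r: "r \<alpha> \<in> multiindices {1..d} 0 (int n)" if "\<alpha> \<in> S" for \<alpha>
    using S(2)[OF that] that by (fastforce simp: multiindices_def r_def)
  define c where "c \<gamma> = (\<Sum>\<alpha>\<in>{\<alpha>\<in>S. r \<alpha> = \<gamma>}. a \<alpha>)" for \<gamma>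
  have "f = trig_sum d (multiindices {1..d} 0 (int n)) c"
  proof
    fix z
    have "f z = (\<Sum>\<alpha>\<in>S. a \<alpha> * character d (r \<alpha>) z)"
      unfolding f by (intro sum.cong refl arg_cong2[where f = "(*)"] fun_cong[OF character_cong]) (auto simp: r_def)
    also have "\<dots> = (\<Sum>\<gamma>\<in>multiindices {1..d} 0 (int n). \<Sum>\<alpha>\<in>{\<alpha>\<in>S. r \<alpha> = \<gamma>}. a \<alpha> * character d (r \<alpha>) z)"
      using r S(1) by (intro sum.group[symmetric]) auto
    also have "\<dots> = trig_sum d (multiindices {1..d} 0 (int n)) c z"
      unfolding trig_sum_def c_def sum_distrib_right by (intro sum.cong refl) auto
    finally show "f z = trig_sum d (multiindices {1..d} 0 (int n)) c z" .
  qed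
  then show ?thesis by (rule that)
qed

text \<open>\<open>K\<close> bounds the square of the norm. One \<open>n\<close> for rows and
  columns is enough, since coefficient vectors can be padded with zeros.\<close>

definition hankel_matrix_bounded :: "nat \<Rightarrow> ((nat \<Rightarrow> complex) \<Rightarrow> complex) \<Rightarrow> real \<Rightarrow> bool" where
  "hankel_matrix_bounded d \<phi> K \<longleftrightarrow> (\<forall>n c.
    (\<Sum>\<beta>\<in>multiindices {1..d} 0 (int n).
      (cmod (\<Sum>\<alpha>\<in>multiindices {1..d} 0 (int n). c \<alpha> * cnj (fourier_coeff d \<phi> (\<alpha> + \<beta>))))\<^sup>2)
    \<le> K * (\<Sum>\<alpha>\<in>multiindices {1..d} 0 (int n). (cmod (c \<alpha>))\<^sup>2))"

lemma parseval_H2: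
  assumes "\<phi> \<in> H2 d"
  shows "(\<lambda>n. \<Sum>\<alpha>\<in>multiindices {1..d} 0 (int n). (cmod (fourier_coeff d \<phi> \<alpha>))\<^sup>2) \<longlonglongrightarrow> (L2_norm d \<phi>)\<^sup>2"
proof -
  have \<phi>: "\<phi> \<in> L2 d" "\<And>\<alpha>. \<exists>i\<in>{1..d}. \<alpha> i < 0 \<Longrightarrow> fourier_coeff d \<phi> \<alpha> = 0"
    using assms unfolding H2_def by blast+
  show ?thesis
  proof (rule parseval[OF \<phi>(1)])
    show "incseq (\<lambda>n. multiindices {1..d} 0 (int n))"
      by (intro incseq_SucI multiindices_mono) auto
    fix \<alpha> assume \<alpha>: "\<alpha> \<in> indices d" "\<alpha> \<notin> (\<Union>n. multiindices {1..d} 0 (int n))"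
    obtain n :: nat where n: "\<alpha> \<in> multiindices {1..d} (- int n) (int n)"
      using index_in_multiindices[OF \<alpha>(1)] .
    have "\<exists>i\<in>{1..d}. \<alpha> i < 0"
    proof (rule ccontr)
      assume "\<not> (\<exists>i\<in>{1..d}. \<alpha> i < 0)"
      with n have "\<alpha> \<in> multiindices {1..d} 0 (int n)"
        by (simp add: multiindices_def not_less)
      with \<alpha>(2) show False by blast
    qed
    then show "fourier_coeff d \<phi> \<alpha> = 0" by (rule \<phi>(2))
  qed (simp_all add: multiindices_subset_indices)
qed

text \<open>The constant function \<open>1\<close> shows that \<^term>\<open>L2_norm d \<phi>\<close> is always a lower bound of the norm, so
  minimality is only an upper bound on the matrix.\<close>

lemma hankel_minimal_norm_iff:
  assumes H2: "\<phi> \<in> H2 d"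
  shows "hankel_minimal_norm d \<phi> \<longleftrightarrow> hankel_matrix_bounded d \<phi> ((L2_norm d \<phi>)\<^sup>2)"
proof
  have \<phi>: "\<phi> \<in> L2 d" using H2 by (simp add: H2_def)
  let ?b = "\<lambda>n. multiindices {1..d} 0 (int n)"
  have sub: "?b n \<subseteq> indices d" for n by (rule multiindices_subset_indices) simp
  {
    assume minimal: "hankel_minimal_norm d \<phi>"
    have le: "L2_norm d (hankel d \<phi> f) \<le> L2_norm d \<phi>"
      if "f \<in> analytic_polynomials d" "L2_norm d f = 1" for f
    proof -
      have "ennreal (L2_norm d (hankel d \<phi> f)) \<le> hankel_norm d \<phi>"
        unfolding hankel_norm_def using that by (intro SUP_upper) auto
      also have "hankel_norm d \<phi> = ennreal (L2_norm d \<phi>)"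
        using minimal by (simp add: hankel_minimal_norm_def)
      finally show ?thesis by (simp add: ennreal_le_iff)
    qed
    show "hankel_matrix_bounded d \<phi> ((L2_norm d \<phi>)\<^sup>2)"
      unfolding hankel_matrix_bounded_def
    proof (intro allI)
      fix n and c :: "(nat \<Rightarrow> int) \<Rightarrow> complex"
      define N where "N = L2_norm d (trig_sum d (?b n) c)"
      have N2: "N\<^sup>2 = (\<Sum>\<alpha>\<in>?b n. (cmod (c \<alpha>))\<^sup>2)"
        unfolding N_def by (rule L2_norm_trig_sum) (auto intro!: sub[THEN subsetD])
      show "(\<Sum>\<beta>\<in>?b n. (cmod (\<Sum>\<alpha>\<in>?b n. c \<alpha> * cnj (fourier_coeff d \<phi> (\<alpha> + \<beta>))))\<^sup>2)
        \<le> (L2_norm d \<phi>)\<^sup>2 * (\<Sum>\<alpha>\<in>?b n. (cmod (c \<alpha>))\<^sup>2)"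
      \<comment> \<open>The polynomial has to be scaled to norm 1; if it has norm 0, all its
        coefficients vanish and both sides are 0.\<close>
      proof (cases "N = 0")
        case True
        then have "(\<Sum>\<alpha>\<in>?b n. (cmod (c \<alpha>))\<^sup>2) = 0" using N2 by simp
        then have "c \<alpha> = 0" if "\<alpha> \<in> ?b n" for \<alpha>
          using that by (subst (asm) sum_nonneg_eq_0_iff) auto
        then show ?thesis by simp
      next
        case False
        then have N: "0 < N" unfolding N_def using L2_norm_nonneg[of d] by (simp add: less_le)
        let ?f = "trig_sum d (?b n) (\<lambda>\<alpha>. c \<alpha> / of_real N)"
        have "(L2_norm d ?f)\<^sup>2 = (\<Sum>\<alpha>\<in>?b n. (cmod (c \<alpha> / of_real N))\<^sup>2)"
          by (rule L2_norm_trig_sum) (auto intro!: sub[THEN subsetD])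
        also have "\<dots> = (\<Sum>\<alpha>\<in>?b n. (cmod (c \<alpha>))\<^sup>2) / N\<^sup>2"
          using N by (simp add: norm_divide power_divide sum_divide_distrib)
        also have "\<dots> = 1" unfolding N2[symmetric] using N by simp
        finally have "L2_norm d ?f = 1"
          by (rule power2_eq_imp_eq[of _ 1, simplified]) auto
        moreover have "?f \<in> analytic_polynomials d"
          unfolding analytic_polynomials_def trig_sum_def[abs_def]
          by (intro CollectI exI[of _ "?b n"] exI[of _ "\<lambda>\<alpha>. c \<alpha> / of_real N"]) (auto intro: nonneg_if_multiindices)
        ultimately have "L2_norm d (hankel d \<phi> ?f) \<le> L2_norm d \<phi>" by (intro le)
        then have 1: "(L2_norm d (hankel d \<phi> ?f))\<^sup>2 \<le> (L2_norm d \<phi>)\<^sup>2" by (intro power_mono) auto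
        let ?s = "\<lambda>m. \<Sum>\<beta>\<in>?b m. (cmod (\<Sum>\<alpha>\<in>?b n. c \<alpha> / of_real N * cnj (fourier_coeff d \<phi> (\<alpha> + \<beta>))))\<^sup>2"
        \<comment> \<open>The sums over growing sets of rows increase to the squared norm of the
          image, so the one with \<open>m = n\<close> lies below it.\<close>
        have "incseq ?s"
          by (intro incseq_SucI sum_mono2 multiindices_mono) auto
        moreover have "?s \<longlonglongrightarrow> (L2_norm d (hankel d \<phi> ?f))\<^sup>2"
          by (rule hankel_norm_limit[OF \<phi>]) simp
        ultimately have "?s n \<le> (L2_norm d (hankel d \<phi> ?f))\<^sup>2" by (rule incseq_le)
        moreover have "?s n = (\<Sum>\<beta>\<in>?b n. (cmod (\<Sum>\<alpha>\<in>?b n. c \<alpha> * cnj (fourier_coeff d \<phi> (\<alpha> + \<beta>))))\<^sup>2) / N\<^sup>2"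
          using N by (simp add: sum_divide_distrib[symmetric] norm_divide power_divide)
        ultimately have "(\<Sum>\<beta>\<in>?b n. (cmod (\<Sum>\<alpha>\<in>?b n. c \<alpha> * cnj (fourier_coeff d \<phi> (\<alpha> + \<beta>))))\<^sup>2) / N\<^sup>2
          \<le> (L2_norm d \<phi>)\<^sup>2"
          using 1 by linarith
        then show ?thesis unfolding N2[symmetric] using N by (simp add: pos_divide_le_eq)
      qed
    qed
  }
  assume bounded: "hankel_matrix_bounded d \<phi> ((L2_norm d \<phi>)\<^sup>2)"
  have "hankel_norm d \<phi> \<le> ennreal (L2_norm d \<phi>)"
    unfolding hankel_norm_def
  proof (rule SUP_least)
    fix f assume "f \<in> {f \<in> analytic_polynomials d. L2_norm d f = 1}"
    then have f: "f \<in> analytic_polynomials d" "L2_norm d f = 1" by auto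
    obtain n c where fc: "f = trig_sum d (?b n) c" using analytic_polynomial_trig_sum[OF f(1)] .
    have c1: "(\<Sum>\<alpha>\<in>?b n. (cmod (c \<alpha>))\<^sup>2) = 1"
      using L2_norm_trig_sum[of "?b n" d c] sub[of n] f(2) by (simp add: fc)
    have "(L2_norm d (hankel d \<phi> f))\<^sup>2 \<le> (L2_norm d \<phi>)\<^sup>2"
      unfolding fc
    proof (rule LIMSEQ_le_const2[OF hankel_norm_limit[OF \<phi>]], simp, intro exI allI impI)
      \<comment> \<open>Once the box of rows contains the box of columns, \<open>c\<close> is padded
        with zeros and the bound on the square section of size \<open>m\<close> applies.\<close>
      fix m assume "n \<le> m"
      then have nm: "?b n \<subseteq> ?b m" by (intro multiindices_mono) auto
      define c' where "c' \<alpha> = (if \<alpha> \<in> ?b n then c \<alpha> else 0)" for \<alpha>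
      have ext: "(\<Sum>\<alpha>\<in>?b n. c \<alpha> * g \<alpha>) = (\<Sum>\<alpha>\<in>?b m. c' \<alpha> * g \<alpha>)" for g
        using nm by (intro sum.mono_neutral_cong_left) (auto simp: c'_def)
      have "(\<Sum>\<alpha>\<in>?b m. (cmod (c' \<alpha>))\<^sup>2) = (\<Sum>\<alpha>\<in>?b n. (cmod (c \<alpha>))\<^sup>2)"
        using nm by (intro sum.mono_neutral_cong_right) (auto simp: c'_def)
      then show "(\<Sum>\<beta>\<in>?b m. (cmod (\<Sum>\<alpha>\<in>?b n. c \<alpha> * cnj (fourier_coeff d \<phi> (\<alpha> + \<beta>))))\<^sup>2) \<le> (L2_norm d \<phi>)\<^sup>2"
        using bounded[unfolded hankel_matrix_bounded_def, rule_format, where n = m and c = c']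
        unfolding ext by (simp only: c1 mult_1_right)
    qed
    then have "L2_norm d (hankel d \<phi> f) \<le> L2_norm d \<phi>" by (rule power2_le_imp_le) simp
    then show "ennreal (L2_norm d (hankel d \<phi> f)) \<le> ennreal (L2_norm d \<phi>)" by (rule ennreal_leI)
  qed
  moreover have "ennreal (L2_norm d \<phi>) \<le> hankel_norm d \<phi>"
  proof -
    \<comment> \<open>The matrix column of index 0 holds the conjugated coefficients of \<phi>, so
      by Parseval the image of 1 has the norm of \<phi>.\<close>
    let ?one = "trig_sum d {0} (\<lambda>_. 1)"
    have "(\<lambda>n. \<Sum>\<alpha>\<in>?b n. (cmod (fourier_coeff d \<phi> \<alpha>))\<^sup>2) \<longlonglongrightarrow> (L2_norm d (hankel d \<phi> ?one))\<^sup>2"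
      using hankel_norm_limit[OF \<phi>, of "{0}" "\<lambda>_. 1"] by simp
    with parseval_H2[OF H2] have "(L2_norm d \<phi>)\<^sup>2 = (L2_norm d (hankel d \<phi> ?one))\<^sup>2"
      by (rule LIMSEQ_unique)
    then have eq: "L2_norm d \<phi> = L2_norm d (hankel d \<phi> ?one)" by (rule power2_eq_imp_eq) auto
    have "(L2_norm d ?one)\<^sup>2 = 1"
      by (subst L2_norm_trig_sum) (auto simp: indices_def)
    then have "L2_norm d ?one = 1"
      by (rule power2_eq_imp_eq[of _ 1, simplified]) auto
    moreover have "?one \<in> analytic_polynomials d"
      unfolding analytic_polynomials_def trig_sum_def[abs_def]
      by (intro CollectI exI[of _ "{0}"] exI[of _ "\<lambda>_. 1"]) auto
    ultimately show ?thesis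
      unfolding eq hankel_norm_def by (intro SUP_upper CollectI conjI)
  qed
  ultimately show "hankel_minimal_norm d \<phi>"
    using H2 by (simp add: hankel_minimal_norm_def)
qed


section \<open>Separate variables\<close>

text \<open>The pointwise half of \<open>depends_only_on\<close>, free of null sets. The value type
  is arbitrary in order to cover the real function \<open>(cmod (f z))\<^sup>2\<close> as
  well.\<close>

definition depends_pointwise :: "nat \<Rightarrow> nat set \<Rightarrow> ((nat \<Rightarrow> complex) \<Rightarrow> 'b) \<Rightarrow> bool" where
  "depends_pointwise d A f \<longleftrightarrow>
    (\<forall>z\<in>space (torus d). \<forall>w\<in>space (torus d). (\<forall>i\<in>A. z i = w i) \<longrightarrow> f z = f w)"

lemma depends_pointwiseD:
  "depends_pointwise d A f \<Longrightarrow> z \<in> space (torus d) \<Longrightarrow> w \<in> space (torus d) \<Longrightarrow>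
    (\<And>i. i \<in> A \<Longrightarrow> z i = w i) \<Longrightarrow> f z = f w"
  unfolding depends_pointwise_def by blast

lemma depends_pointwise_compose2:
  assumes "depends_pointwise d A f" "depends_pointwise d A g"
  shows "depends_pointwise d A (\<lambda>z. h (f z) (g z))"
  using assms unfolding depends_pointwise_def by metis

lemma depends_pointwise_compose:
  assumes "depends_pointwise d A f"
  shows "depends_pointwise d A (\<lambda>z. h (f z))"
  using assms unfolding depends_pointwise_def by metis

text \<open>Some values are needed for the variables on which a function does not depend.\<close>

definition some_point :: "nat \<Rightarrow> complex" where "some_point = (\<lambda>_. 1)"

text \<open>\<open>some_point\<close> need not lie in the product space over \<open>B\<close>, but
  \<open>merge\<close> reads it on \<open>B\<close> only, where its value 1 is on the
  circle.\<close>

lemma merge_in_torus: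
  assumes "A \<inter> B = {}" "A \<union> B = {1..d}"
    "x \<in> space (\<Pi>\<^sub>M i\<in>A. circle)" "y \<in> space (\<Pi>\<^sub>M i\<in>B. circle) \<or> y = some_point"
  shows "merge A B (x, y) \<in> space (torus d)"
proof -
  have c: "space circle = sphere 0 1" by (simp add: circle_def space_restrict_space)
  have "merge A B (x, y) i \<in> sphere 0 1" if "i \<in> {1..d}" for i
  proof (cases "i \<in> A")
    case True
    then have "merge A B (x, y) i = x i" by (simp add: merge_def)
    moreover have "x i \<in> sphere 0 1"
      using assms(3) True unfolding space_PiM c by (rule PiE_mem)
    ultimately show ?thesis by (simp only:)
  next
    case False
    then have "i \<in> B" using that assms(2) by blast
    then have eq: "merge A B (x, y) i = y i" using False by (simp add: merge_def)
    show ?thesis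
      using assms(4)
    proof
      assume "y \<in> space (\<Pi>\<^sub>M i\<in>B. circle)"
      then have "y i \<in> sphere 0 1"
        using \<open>i \<in> B\<close> unfolding space_PiM c by (rule PiE_mem)
      then show ?thesis by (simp only: eq)
    next
      assume "y = some_point"
      then show ?thesis unfolding eq by (simp add: some_point_def)
    qed
  qed
  moreover have "merge A B (x, y) i = undefined" if "i \<notin> {1..d}" for i
    using that unfolding assms(2)[symmetric] by (simp add: merge_def)
  ultimately show ?thesis unfolding space_torus by (intro PiE_I)
qed

lemma merge_apply:
  "i \<in> A \<Longrightarrow> merge A B (x, y) i = x i"
  "A \<inter> B = {} \<Longrightarrow> i \<in> B \<Longrightarrow> merge A B (x, y) i = y i"
  by (auto simp: merge_def)

lemma torus_distr_merge:
  assumes "A \<inter> B = {}" "A \<union> B = {1..d}"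
  shows "distr ((\<Pi>\<^sub>M i\<in>A. circle) \<Otimes>\<^sub>M (\<Pi>\<^sub>M i\<in>B. circle)) (torus d) (merge A B) = torus d"
proof -
  have "finite A" "finite B" using assms by (metis finite_Un finite_atLeastAtMost)+
  then show ?thesis
    using circles.distr_merge[OF assms(1)] unfolding torus_def assms(2) by blast
qed

lemma merge_measurable_torus:
  assumes "A \<union> B = {1..d}"
  shows "merge A B \<in> (\<Pi>\<^sub>M i\<in>A. circle) \<Otimes>\<^sub>M (\<Pi>\<^sub>M i\<in>B. circle) \<rightarrow>\<^sub>M torus d"
  using measurable_merge[of A B "\<lambda>_. circle"] by (simp only: torus_def assms)

context
  fixes d :: nat and A B :: "nat set"
  assumes AB: "A \<inter> B = {}" "A \<union> B = {1..d}"
begin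

interpretation PA: prob_space "\<Pi>\<^sub>M i\<in>A. circle"
  by (intro prob_space_PiM prob_space_circle)

interpretation PB: prob_space "\<Pi>\<^sub>M i\<in>B. circle"
  by (intro prob_space_PiM prob_space_circle)

interpretation PAB: pair_prob_space "\<Pi>\<^sub>M i\<in>A. circle" "\<Pi>\<^sub>M i\<in>B. circle" ..

text \<open>Along the variables in \<open>B\<close> the integrand is constant, so the inner integral
  of Fubini's theorem, over a space of mass 1, returns the value at
  \<open>some_point\<close>.\<close>

lemma integral_depends_pointwise:
  fixes f :: "(nat \<Rightarrow> complex) \<Rightarrow> 'b :: {banach, second_countable_topology}"
  assumes f: "integrable (torus d) f" and dep: "depends_pointwise d A f"
  shows "integrable (\<Pi>\<^sub>M i\<in>A. circle) (\<lambda>x. f (merge A B (x, some_point)))"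
    and "(LINT x|(\<Pi>\<^sub>M i\<in>A. circle). f (merge A B (x, some_point))) = (LINT z|torus d. f z)"
proof -
  let ?F = "\<lambda>x. f (merge A B (x, some_point))"
  have int: "integrable ((\<Pi>\<^sub>M i\<in>A. circle) \<Otimes>\<^sub>M (\<Pi>\<^sub>M i\<in>B. circle)) (\<lambda>p. f (merge A B p))"
    by (rule integrable_distr[OF merge_measurable_torus[OF AB(2)]]) (simp add: torus_distr_merge[OF AB] f)
  have eq: "f (merge A B (x, y)) = ?F x"
    if "x \<in> space (\<Pi>\<^sub>M i\<in>A. circle)" "y \<in> space (\<Pi>\<^sub>M i\<in>B. circle)" for x y
    using that by (intro depends_pointwiseD[OF dep] merge_in_torus[OF AB]) (simp_all add: merge_apply)
  have inner: "(LINT y|(\<Pi>\<^sub>M i\<in>B. circle). f (merge A B (x, y))) = ?F x"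
    if "x \<in> space (\<Pi>\<^sub>M i\<in>A. circle)" for x
  proof -
    have "(LINT y|(\<Pi>\<^sub>M i\<in>B. circle). f (merge A B (x, y))) = (LINT y|(\<Pi>\<^sub>M i\<in>B. circle). ?F x)"
      by (intro Bochner_Integration.integral_cong refl eq that)
    moreover have "measure (\<Pi>\<^sub>M i\<in>B. circle) (space (\<Pi>\<^sub>M i\<in>B. circle)) = 1"
      by (intro prob_space.prob_space prob_space_PiM prob_space_circle)
    ultimately show ?thesis by simp
  qed
  show "integrable (\<Pi>\<^sub>M i\<in>A. circle) ?F"
    using PAB.integrable_fst'[OF int] by (subst (asm) Bochner_Integration.integrable_cong[OF refl inner])
  have "(LINT z|torus d. f z) = (LINT p|((\<Pi>\<^sub>M i\<in>A. circle) \<Otimes>\<^sub>M (\<Pi>\<^sub>M i\<in>B. circle)). f (merge A B p))"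
    by (subst torus_distr_merge[OF AB, symmetric], rule integral_distr[OF merge_measurable_torus[OF AB(2)]])
      (use f in auto)
  also have "\<dots> = (LINT x|(\<Pi>\<^sub>M i\<in>A. circle). LINT y|(\<Pi>\<^sub>M i\<in>B. circle). f (merge A B (x, y)))"
    by (rule PAB.integral_fst'[OF int, symmetric])
  also have "\<dots> = (LINT x|(\<Pi>\<^sub>M i\<in>A. circle). ?F x)"
    by (intro Bochner_Integration.integral_cong refl inner)
  finally show "(LINT x|(\<Pi>\<^sub>M i\<in>A. circle). ?F x) = (LINT z|torus d. f z)" by simp
qed

end

text \<open>Functions of separate variables are independent. Under \<open>merge\<close> the
  integrand becomes \<open>?F x * ?G y\<close>, and Fubini yields both the integrability of the
  product and the factorization of its integral.\<close>

lemma integral_mult_separate: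
  fixes f g :: "(nat \<Rightarrow> complex) \<Rightarrow> 'b :: {real_normed_field, banach, second_countable_topology}"
  assumes AB: "A \<inter> B = {}" "A \<union> B = {1..d}"
    and f: "integrable (torus d) f" "depends_pointwise d A f"
    and g: "integrable (torus d) g" "depends_pointwise d B g"
  shows "integrable (torus d) (\<lambda>z. f z * g z)"
    and "(LINT z|torus d. f z * g z) = (LINT z|torus d. f z) * (LINT z|torus d. g z)"
proof -
  let ?A = "\<Pi>\<^sub>M i\<in>A. circle" and ?B = "\<Pi>\<^sub>M i\<in>B. circle"
  interpret PA: prob_space ?A by (intro prob_space_PiM prob_space_circle)
  interpret PB: prob_space ?B by (intro prob_space_PiM prob_space_circle)
  interpret PAB: pair_prob_space ?A ?B ..
  have BA: "B \<inter> A = {}" "B \<union> A = {1..d}" using AB by auto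
  let ?F = "\<lambda>x. f (merge A B (x, some_point))" and ?G = "\<lambda>y. g (merge B A (y, some_point))"
  note F = integral_depends_pointwise[OF AB f] and G = integral_depends_pointwise[OF BA g]
  note [measurable] = borel_measurable_integrable[OF F(1)] borel_measurable_integrable[OF G(1)]
    borel_measurable_integrable[OF f(1)] borel_measurable_integrable[OF g(1)] merge_measurable_torus[OF AB(2)]
  have eq: "f (merge A B (x, y)) * g (merge A B (x, y)) = ?F x * ?G y"
    if "x \<in> space ?A" "y \<in> space ?B" for x y
  proof (intro arg_cong2[where f = "(*)"])
    show "f (merge A B (x, y)) = ?F x"
      using that by (intro depends_pointwiseD[OF f(2)] merge_in_torus[OF AB]) (simp_all add: merge_apply)
    show "g (merge A B (x, y)) = ?G y"
      using that by (intro depends_pointwiseD[OF g(2)] merge_in_torus[OF AB] merge_in_torus[OF BA])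
        (simp_all add: merge_apply AB BA)
  qed
  have prod_int: "integrable (?A \<Otimes>\<^sub>M ?B) (\<lambda>(x, y). ?F x * ?G y)"
  proof (rule PAB.Fubini_integrable)
    show "(\<lambda>(x, y). ?F x * ?G y) \<in> borel_measurable (?A \<Otimes>\<^sub>M ?B)" by measurable
    show "integrable ?A (\<lambda>x. LINT y|?B. norm (case (x, y) of (x, y) \<Rightarrow> ?F x * ?G y))"
      using F(1) by (simp add: norm_mult)
    show "AE x in ?A. integrable ?B (\<lambda>y. case (x, y) of (x, y) \<Rightarrow> ?F x * ?G y)"
      using G(1) by simp
  qed
  have int: "integrable (?A \<Otimes>\<^sub>M ?B) (\<lambda>p. f (merge A B p) * g (merge A B p))"
    using prod_int by (rule Bochner_Integration.integrable_cong[OF refl, THEN iffD1, rotated])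
      (auto simp: space_pair_measure eq)
  then show "integrable (torus d) (\<lambda>z. f z * g z)"
    by (subst torus_distr_merge[OF AB, symmetric], subst integrable_distr_eq) measurable
  have "(LINT z|torus d. f z * g z) = (LINT p|(?A \<Otimes>\<^sub>M ?B). f (merge A B p) * g (merge A B p))"
    by (subst torus_distr_merge[OF AB, symmetric], rule integral_distr) measurable
  also have "\<dots> = (LINT p|(?A \<Otimes>\<^sub>M ?B). (case p of (x, y) \<Rightarrow> ?F x * ?G y))"
    by (intro Bochner_Integration.integral_cong refl) (auto simp: space_pair_measure eq)
  also have "\<dots> = (LINT x|?A. LINT y|?B. ?F x * ?G y)"
    using PAB.integral_fst'[OF prod_int] by simp
  also have "\<dots> = (LINT x|?A. ?F x) * (LINT y|?B. ?G y)" by simp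
  finally show "(LINT z|torus d. f z * g z) = (LINT z|torus d. f z) * (LINT z|torus d. g z)"
    by (simp only: F(2) G(2))
qed

section \<open>Fourier coefficients and separate variables\<close>

definition index_part :: "nat set \<Rightarrow> (nat \<Rightarrow> int) \<Rightarrow> nat \<Rightarrow> int" where
  "index_part A \<alpha> i = (if i \<in> A then \<alpha> i else 0)"

lemma depends_pointwise_character: "depends_pointwise d A (character d (index_part A \<alpha>))"
  unfolding depends_pointwise_def character_def
proof (intro ballI impI prod.cong refl)
  fix z w :: "nat \<Rightarrow> complex" and i assume "\<forall>i\<in>A. z i = w i"
  then show "z i powi index_part A \<alpha> i = w i powi index_part A \<alpha> i"
    by (cases "i \<in> A") (auto simp: index_part_def)
qed

text \<open>The character of \<alpha> is the product of the characters of its two parts, each a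
  function of one group of variables, so \<open>integral_mult_separate\<close> applies.\<close>

lemma fourier_coeff_mult_pointwise:
  assumes AB: "A \<inter> B = {}" "A \<union> B = {1..d}"
    and f: "f \<in> L2 d" "depends_pointwise d A f" and g: "g \<in> L2 d" "depends_pointwise d B g"
  shows "fourier_coeff d (\<lambda>z. f z * g z) \<alpha> = fourier_coeff d f (index_part A \<alpha>) * fourier_coeff d g (index_part B \<alpha>)"
proof -
  have int: "integrable (torus d) (\<lambda>z. u z * character d \<gamma> z)" if "u \<in> L2 d" for u \<gamma>
    by (intro L2_integrable_mult that character_L2)
  have minus: "- index_part X \<alpha> = index_part X (- \<alpha>)" for X
    by (auto simp: index_part_def)
  have dep: "depends_pointwise d X (\<lambda>z. u z * character d (- index_part X \<alpha>) z)" if "depends_pointwise d X u"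
    for X and u :: "(nat \<Rightarrow> complex) \<Rightarrow> complex"
    unfolding minus by (rule depends_pointwise_compose2[OF that depends_pointwise_character])
  have "fourier_coeff d (\<lambda>z. f z * g z) \<alpha> =
    (LINT z|torus d. (f z * character d (- index_part A \<alpha>) z) * (g z * character d (- index_part B \<alpha>) z))"
    unfolding fourier_coeff_eq_integral
  proof (intro Bochner_Integration.integral_cong refl)
    fix z assume z: "z \<in> space (torus d)"
    have "character d (- \<alpha>) = character d (- index_part A \<alpha> + - index_part B \<alpha>)"
      using AB by (intro character_cong) (auto simp: index_part_def)
    then show "f z * g z * character d (- \<alpha>) z =
        f z * character d (- index_part A \<alpha>) z * (g z * character d (- index_part B \<alpha>) z)"
      by (simp only: character_add[OF z] mult_ac)
  qed
  also have "\<dots> = fourier_coeff d f (index_part A \<alpha>) * fourier_coeff d g (index_part B \<alpha>)"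
    unfolding fourier_coeff_eq_integral
    by (intro integral_mult_separate(2)[OF AB] int dep f g)
  finally show ?thesis .
qed

lemma depends_only_on_L2:
  assumes "depends_only_on d A f" "f \<in> L2 d"
  obtains f' where "f' \<in> L2 d" "depends_pointwise d A f'" "AE z in torus d. f z = f' z"
proof -
  obtain f' where f': "f' \<in> borel_measurable (torus d)" "depends_pointwise d A f'" "AE z in torus d. f z = f' z"
    using assms(1) unfolding depends_only_on_def depends_pointwise_def by blast
  note [measurable] = f'(1) L2_measurable[OF assms(2)]
  have "integrable (torus d) (\<lambda>z. (cmod (f' z))\<^sup>2)"
    using L2_integrable_square[OF assms(2)]
    by (rule integrable_cong_AE_imp) (use f'(3) in \<open>auto elim: eventually_mono\<close>)
  then have "f' \<in> L2 d" using f'(1) by (simp add: L2_def)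
  with f'(2,3) show ?thesis by (intro that)
qed

lemma depends_only_on_mono: "depends_only_on d A f \<Longrightarrow> A \<subseteq> A' \<Longrightarrow> depends_only_on d A' f"
  unfolding depends_only_on_def by (meson subsetD)

text \<open>Reduces to representatives that depend pointwise on their variables. Their squared
  moduli then depend on separate variables too; factoring the integral of the product shows that
  \<open>f z * g z\<close> is square integrable.\<close>

lemma separate_variables_mult:
  assumes AB: "A \<inter> B = {}" "A \<union> B = {1..d}"
    and f: "f \<in> L2 d" "depends_only_on d A f" and g: "g \<in> L2 d" "depends_only_on d B g"
  shows "(\<lambda>z. f z * g z) \<in> L2 d"
    and "(L2_norm d (\<lambda>z. f z * g z))\<^sup>2 = (L2_norm d f)\<^sup>2 * (L2_norm d g)\<^sup>2"
    and "fourier_coeff d (\<lambda>z. f z * g z) \<alpha> = fourier_coeff d f (index_part A \<alpha>) * fourier_coeff d g (index_part B \<alpha>)"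
proof -
  obtain f' where f': "f' \<in> L2 d" "depends_pointwise d A f'" "AE z in torus d. f z = f' z"
    using depends_only_on_L2[OF f(2,1)] .
  obtain g' where g': "g' \<in> L2 d" "depends_pointwise d B g'" "AE z in torus d. g z = g' z"
    using depends_only_on_L2[OF g(2,1)] .
  note [measurable] = L2_measurable[OF f(1)] L2_measurable[OF g(1)] L2_measurable[OF f'(1)] L2_measurable[OF g'(1)]
  have AE: "AE z in torus d. f z * g z = f' z * g' z"
    using f'(3) g'(3) by eventually_elim simp
  have sq: "depends_pointwise d A (\<lambda>z. (cmod (f' z))\<^sup>2)" "depends_pointwise d B (\<lambda>z. (cmod (g' z))\<^sup>2)"
    by (rule depends_pointwise_compose[OF f'(2)], rule depends_pointwise_compose[OF g'(2)])
  note sep = integral_mult_separate[OF AB L2_integrable_square[OF f'(1)] sq(1) L2_integrable_square[OF g'(1)] sq(2)]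
  have L2': "(\<lambda>z. f' z * g' z) \<in> L2 d"
    using sep(1) by (simp add: L2_def norm_mult power_mult_distrib)
  have "integrable (torus d) (\<lambda>z. (cmod (f z * g z))\<^sup>2)"
    using L2_integrable_square[OF L2']
    by (rule integrable_cong_AE_imp) (use AE in \<open>auto elim: eventually_mono\<close>)
  then show L2: "(\<lambda>z. f z * g z) \<in> L2 d" by (simp add: L2_def)
  have "(L2_norm d (\<lambda>z. f z * g z))\<^sup>2 = (LINT z|torus d. (cmod (f' z))\<^sup>2 * (cmod (g' z))\<^sup>2)"
    unfolding L2_norm_cong_AE[OF L2 L2' AE] L2_norm_square by (simp add: norm_mult power_mult_distrib)
  also have "\<dots> = (L2_norm d f)\<^sup>2 * (L2_norm d g)\<^sup>2"
    unfolding sep(2) L2_norm_cong_AE[OF f(1) f'(1,3)] L2_norm_cong_AE[OF g(1) g'(1,3)] L2_norm_square ..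
  finally show "(L2_norm d (\<lambda>z. f z * g z))\<^sup>2 = (L2_norm d f)\<^sup>2 * (L2_norm d g)\<^sup>2" .
  have "fourier_coeff d (\<lambda>z. f z * g z) \<alpha> = fourier_coeff d (\<lambda>z. f' z * g' z) \<alpha>"
    using AE by (intro fourier_coeff_cong_AE) measurable
  also have "\<dots> = fourier_coeff d f' (index_part A \<alpha>) * fourier_coeff d g' (index_part B \<alpha>)"
    by (rule fourier_coeff_mult_pointwise[OF AB f'(1,2) g'(1,2)])
  also have "fourier_coeff d f' = fourier_coeff d f"
    by (rule ext, rule fourier_coeff_cong_AE[symmetric]) (use f'(3) in measurable)
  also have "fourier_coeff d g' = fourier_coeff d g"
    by (rule ext, rule fourier_coeff_cong_AE[symmetric]) (use g'(3) in measurable)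
  finally show "fourier_coeff d (\<lambda>z. f z * g z) \<alpha> = fourier_coeff d f (index_part A \<alpha>) * fourier_coeff d g (index_part B \<alpha>)" .
qed

text \<open>Multiplying \<open>f\<close> by the constant 1, regarded as a function of the remaining
  variables, factors the coefficient; the second factor is a coefficient of 1 at a nonzero
  frequency.\<close>

lemma fourier_coeff_depends_only_on:
  assumes A: "A \<subseteq> {1..d}" and f: "f \<in> L2 d" "depends_only_on d A f"
    and i: "i \<in> {1..d}" "i \<notin> A" "\<alpha> i \<noteq> 0"
  shows "fourier_coeff d f \<alpha> = 0"
proof -
  let ?B = "{1..d} - A"
  have one: "character d 0 \<in> L2 d" "depends_only_on d ?B (character d 0)"
    by (rule character_L2) (auto simp: depends_only_on_def fun_eq_iff intro!: bexI[of _ "\<lambda>_. 1"])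
  have "fourier_coeff d (\<lambda>z. f z * character d 0 z) \<alpha> =
      fourier_coeff d f (index_part A \<alpha>) * fourier_coeff d (character d 0) (index_part ?B \<alpha>)"
    using A by (intro separate_variables_mult(3) f one) auto
  also have "fourier_coeff d (character d 0) (index_part ?B \<alpha>) = 0"
    unfolding fourier_coeff_character using i by (auto simp: index_part_def)
  finally show ?thesis by (simp only: character_zero mult_1_right mult_zero_right)
qed


section \<open>Products and sums\<close>

text \<open>The matrix on the left is \<open>(M\<^sub>1 \<otimes> 1)(1 \<otimes> M\<^sub>2)\<close>.\<close>

lemma tensor_product_bound:
  fixes M\<^sub>1 :: "'a \<Rightarrow> 'b \<Rightarrow> complex" and M\<^sub>2 :: "'c \<Rightarrow> 'e \<Rightarrow> complex"
  assumes M\<^sub>1: "\<And>c. (\<Sum>y\<in>Y\<^sub>1. (cmod (\<Sum>x\<in>X\<^sub>1. c x * M\<^sub>1 x y))\<^sup>2) \<le> K\<^sub>1 * (\<Sum>x\<in>X\<^sub>1. (cmod (c x))\<^sup>2)"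
    and M\<^sub>2: "\<And>c. (\<Sum>y\<in>Y\<^sub>2. (cmod (\<Sum>x\<in>X\<^sub>2. c x * M\<^sub>2 x y))\<^sup>2) \<le> K\<^sub>2 * (\<Sum>x\<in>X\<^sub>2. (cmod (c x))\<^sup>2)"
    and "0 \<le> K\<^sub>2"
  shows "(\<Sum>y\<in>Y\<^sub>1. \<Sum>y'\<in>Y\<^sub>2. (cmod (\<Sum>x\<in>X\<^sub>1. \<Sum>x'\<in>X\<^sub>2. c x x' * (M\<^sub>1 x y * M\<^sub>2 x' y')))\<^sup>2)
    \<le> K\<^sub>1 * K\<^sub>2 * (\<Sum>x\<in>X\<^sub>1. \<Sum>x'\<in>X\<^sub>2. (cmod (c x x'))\<^sup>2)"
proof -
  have "(\<Sum>x\<in>X\<^sub>1. \<Sum>x'\<in>X\<^sub>2. c x x' * (M\<^sub>1 x y * M\<^sub>2 x' y')) = (\<Sum>x'\<in>X\<^sub>2. (\<Sum>x\<in>X\<^sub>1. c x x' * M\<^sub>1 x y) * M\<^sub>2 x' y')" for y y'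
    unfolding sum_distrib_right by (subst sum.swap) (simp add: mult.assoc)
  then have "(\<Sum>y\<in>Y\<^sub>1. \<Sum>y'\<in>Y\<^sub>2. (cmod (\<Sum>x\<in>X\<^sub>1. \<Sum>x'\<in>X\<^sub>2. c x x' * (M\<^sub>1 x y * M\<^sub>2 x' y')))\<^sup>2)
      = (\<Sum>y\<in>Y\<^sub>1. \<Sum>y'\<in>Y\<^sub>2. (cmod (\<Sum>x'\<in>X\<^sub>2. (\<Sum>x\<in>X\<^sub>1. c x x' * M\<^sub>1 x y) * M\<^sub>2 x' y'))\<^sup>2)"
    by simp
  \<comment> \<open>For fixed \<open>y\<close> the bound on \<open>M\<^sub>2\<close> applies to the
    vector with entries \<open>\<Sum>x\<in>X\<^sub>1. c x x' * M\<^sub>1 x y\<close>; below, the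
    bound on \<open>M\<^sub>1\<close> applies for each fixed \<open>x'\<close>.\<close>
  also have "\<dots> \<le> (\<Sum>y\<in>Y\<^sub>1. K\<^sub>2 * (\<Sum>x'\<in>X\<^sub>2. (cmod (\<Sum>x\<in>X\<^sub>1. c x x' * M\<^sub>1 x y))\<^sup>2))"
    by (intro sum_mono M\<^sub>2)
  also have "\<dots> = K\<^sub>2 * (\<Sum>x'\<in>X\<^sub>2. \<Sum>y\<in>Y\<^sub>1. (cmod (\<Sum>x\<in>X\<^sub>1. c x x' * M\<^sub>1 x y))\<^sup>2)"
    unfolding sum_distrib_left[symmetric] by (subst sum.swap) simp
  also have "\<dots> \<le> K\<^sub>2 * (\<Sum>x'\<in>X\<^sub>2. K\<^sub>1 * (\<Sum>x\<in>X\<^sub>1. (cmod (c x x'))\<^sup>2))"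
    using \<open>0 \<le> K\<^sub>2\<close> by (intro mult_left_mono sum_mono M\<^sub>1)
  also have "\<dots> = K\<^sub>1 * K\<^sub>2 * (\<Sum>x\<in>X\<^sub>1. \<Sum>x'\<in>X\<^sub>2. (cmod (c x x'))\<^sup>2)"
    unfolding sum_distrib_left[symmetric] by (subst sum.swap) simp
  finally show ?thesis .
qed

lemma sum_multiindices_split:
  assumes "A \<inter> B = {}" "A \<union> B = {1..d}"
  shows "(\<Sum>\<alpha>\<in>multiindices {1..d} m n. F \<alpha>) = (\<Sum>a\<in>multiindices A m n. \<Sum>b\<in>multiindices B m n. F (a + b))"
  unfolding sum.cartesian_product
proof (rule sum.reindex_bij_witness[of _ "\<lambda>(a, b). a + b" "\<lambda>\<alpha>. (index_part A \<alpha>, index_part B \<alpha>)"])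
  fix p assume p: "p \<in> multiindices A m n \<times> multiindices B m n"
  then obtain a b where ab: "p = (a, b)" "a \<in> multiindices A m n" "b \<in> multiindices B m n" by auto
  then show "(case p of (a, b) \<Rightarrow> a + b) \<in> multiindices {1..d} m n"
    using assms(1) unfolding assms(2)[symmetric] by (auto simp: multiindices_def)
  show "(index_part A (case p of (a, b) \<Rightarrow> a + b), index_part B (case p of (a, b) \<Rightarrow> a + b)) = p"
    using ab assms(1) by (auto simp: index_part_def multiindices_def fun_eq_iff)
next
  fix \<alpha> assume \<alpha>: "\<alpha> \<in> multiindices {1..d} m n"
  then show sum: "(case (index_part A \<alpha>, index_part B \<alpha>) of (a, b) \<Rightarrow> a + b) = \<alpha>"
    using assms(1) unfolding assms(2)[symmetric] by (auto simp: index_part_def multiindices_def fun_eq_iff)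
  show "(index_part A \<alpha>, index_part B \<alpha>) \<in> multiindices A m n \<times> multiindices B m n"
    using \<alpha> unfolding assms(2)[symmetric] by (auto simp: index_part_def multiindices_def)
  show "(case (index_part A \<alpha>, index_part B \<alpha>) of (a, b) \<Rightarrow> F (a + b)) = F \<alpha>"
    using sum by simp
qed

text \<open>Entries off \<open>A\<close> are 0, which the bounds on \<open>m\<close> and
  \<open>n\<close> place in the interval.\<close>

lemma multiindices_subset_index_set:
  assumes "A \<subseteq> A'" "m \<le> 0" "0 \<le> n"
  shows "multiindices A m n \<subseteq> multiindices A' m n"
proof
  fix \<alpha> assume \<alpha>: "\<alpha> \<in> multiindices A m n"
  have "\<alpha> i \<in> {m..n}" for i
    using \<alpha> assms(2,3) by (cases "i \<in> A") (auto simp: multiindices_def)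
  then show "\<alpha> \<in> multiindices A' m n"
    using \<alpha> assms(1) by (auto simp: multiindices_def)
qed

text \<open>Compression to a block: padding \<open>c\<close> with zeros selects the columns, and
  dropping rows only decreases the left-hand side.\<close>

lemma hankel_matrix_bounded_subset:
  assumes bounded: "hankel_matrix_bounded d \<phi> K" and A: "A \<subseteq> {1..d}"
  shows "(\<Sum>\<beta>\<in>multiindices A 0 (int n). (cmod (\<Sum>\<alpha>\<in>multiindices A 0 (int n). c \<alpha> * cnj (fourier_coeff d \<phi> (\<alpha> + \<beta>))))\<^sup>2)
    \<le> K * (\<Sum>\<alpha>\<in>multiindices A 0 (int n). (cmod (c \<alpha>))\<^sup>2)"
proof -
  let ?a = "multiindices A 0 (int n)" and ?b = "multiindices {1..d} 0 (int n)"
  have ab: "?a \<subseteq> ?b" using A by (intro multiindices_subset_index_set) auto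
  define c' where "c' \<alpha> = (if \<alpha> \<in> ?a then c \<alpha> else 0)" for \<alpha>
  have ext: "(\<Sum>\<alpha>\<in>?a. c \<alpha> * g \<alpha>) = (\<Sum>\<alpha>\<in>?b. c' \<alpha> * g \<alpha>)" for g
    using ab by (intro sum.mono_neutral_cong_left) (auto simp: c'_def)
  have "(\<Sum>\<beta>\<in>?a. (cmod (\<Sum>\<alpha>\<in>?a. c \<alpha> * cnj (fourier_coeff d \<phi> (\<alpha> + \<beta>))))\<^sup>2)
      \<le> (\<Sum>\<beta>\<in>?b. (cmod (\<Sum>\<alpha>\<in>?a. c \<alpha> * cnj (fourier_coeff d \<phi> (\<alpha> + \<beta>))))\<^sup>2)"
    using ab by (intro sum_mono2) auto
  also have "\<dots> \<le> K * (\<Sum>\<alpha>\<in>?b. (cmod (c' \<alpha>))\<^sup>2)"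
    unfolding ext by (rule bounded[unfolded hankel_matrix_bounded_def, rule_format])
  also have "(\<Sum>\<alpha>\<in>?b. (cmod (c' \<alpha>))\<^sup>2) = (\<Sum>\<alpha>\<in>?a. (cmod (c \<alpha>))\<^sup>2)"
    using ab by (intro sum.mono_neutral_cong_right) (auto simp: c'_def)
  finally show ?thesis .
qed

section \<open>Two symbols in complementary groups of variables\<close>

context
  fixes d :: nat and A B :: "nat set" and \<phi>\<^sub>1 \<phi>\<^sub>2 :: "(nat \<Rightarrow> complex) \<Rightarrow> complex"
  assumes AB: "A \<inter> B = {}" "A \<union> B = {1..d}"
    and \<phi>\<^sub>1: "\<phi>\<^sub>1 \<in> H2 d" "depends_only_on d A \<phi>\<^sub>1"
    and \<phi>\<^sub>2: "\<phi>\<^sub>2 \<in> H2 d" "depends_only_on d B \<phi>\<^sub>2"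
begin

private lemma L2s: "\<phi>\<^sub>1 \<in> L2 d" "\<phi>\<^sub>2 \<in> L2 d"
  using \<phi>\<^sub>1(1) \<phi>\<^sub>2(1) by (simp_all add: H2_def)

private lemma H2s: "\<exists>i\<in>{1..d}. \<alpha> i < 0 \<Longrightarrow> fourier_coeff d \<phi>\<^sub>1 \<alpha> = 0"
  "\<exists>i\<in>{1..d}. \<alpha> i < 0 \<Longrightarrow> fourier_coeff d \<phi>\<^sub>2 \<alpha> = 0"
  using \<phi>\<^sub>1(1) \<phi>\<^sub>2(1) unfolding H2_def by blast+

private lemma subs: "A \<subseteq> {1..d}" "B \<subseteq> {1..d}"
  using AB(2) by blast+

lemma product_H2: "(\<lambda>z. \<phi>\<^sub>1 z * \<phi>\<^sub>2 z) \<in> H2 d"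
  unfolding H2_def
proof (intro CollectI conjI allI impI)
  show "(\<lambda>z. \<phi>\<^sub>1 z * \<phi>\<^sub>2 z) \<in> L2 d"
    by (rule separate_variables_mult(1)[OF AB L2s(1) \<phi>\<^sub>1(2) L2s(2) \<phi>\<^sub>2(2)])
  fix \<alpha> :: "nat \<Rightarrow> int" assume "\<exists>i\<in>{1..d}. \<alpha> i < 0"
  then obtain i where i: "i \<in> {1..d}" "\<alpha> i < 0" by blast
  have "i \<in> A \<or> i \<in> B" using i(1) unfolding AB(2)[symmetric] by blast
  then have "index_part A \<alpha> i < 0 \<or> index_part B \<alpha> i < 0"
    using i(2) by (auto simp: index_part_def)
  then have "fourier_coeff d \<phi>\<^sub>1 (index_part A \<alpha>) = 0 \<or> fourier_coeff d \<phi>\<^sub>2 (index_part B \<alpha>) = 0"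
    using i(1) H2s by blast
  then show "fourier_coeff d (\<lambda>z. \<phi>\<^sub>1 z * \<phi>\<^sub>2 z) \<alpha> = 0"
    unfolding separate_variables_mult(3)[OF AB L2s(1) \<phi>\<^sub>1(2) L2s(2) \<phi>\<^sub>2(2)] by auto
qed

text \<open>With rows and columns split along \<open>A\<close> and \<open>B\<close>, each entry is a
  product of entries of the two matrices, so \<open>tensor_product_bound\<close> applies.\<close>

lemma hankel_matrix_bounded_product:
  assumes "hankel_matrix_bounded d \<phi>\<^sub>1 K\<^sub>1" "hankel_matrix_bounded d \<phi>\<^sub>2 K\<^sub>2" "0 \<le> K\<^sub>2"
  shows "hankel_matrix_bounded d (\<lambda>z. \<phi>\<^sub>1 z * \<phi>\<^sub>2 z) (K\<^sub>1 * K\<^sub>2)"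
  unfolding hankel_matrix_bounded_def
proof (intro allI)
  fix n and c :: "(nat \<Rightarrow> int) \<Rightarrow> complex"
  let ?a = "multiindices A 0 (int n)" and ?b = "multiindices B 0 (int n)"
  have disjoint: "i \<in> A \<Longrightarrow> i \<notin> B" "i \<in> B \<Longrightarrow> i \<notin> A" for i using AB(1) by blast+
  have coeff: "fourier_coeff d (\<lambda>z. \<phi>\<^sub>1 z * \<phi>\<^sub>2 z) ((a + b) + (a' + b')) =
      fourier_coeff d \<phi>\<^sub>1 (a + a') * fourier_coeff d \<phi>\<^sub>2 (b + b')"
    if "a \<in> ?a" "b \<in> ?b" "a' \<in> ?a" "b' \<in> ?b" for a b a' b'
  proof -
    have "index_part A ((a + b) + (a' + b')) = a + a'" "index_part B ((a + b) + (a' + b')) = b + b'"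
      using that disjoint by (auto simp: index_part_def multiindices_def fun_eq_iff)
    then show ?thesis
      by (simp only: separate_variables_mult(3)[OF AB L2s(1) \<phi>\<^sub>1(2) L2s(2) \<phi>\<^sub>2(2)])
  qed
  have "(\<Sum>\<beta>\<in>multiindices {1..d} 0 (int n).
      (cmod (\<Sum>\<alpha>\<in>multiindices {1..d} 0 (int n). c \<alpha> * cnj (fourier_coeff d (\<lambda>z. \<phi>\<^sub>1 z * \<phi>\<^sub>2 z) (\<alpha> + \<beta>))))\<^sup>2)
    = (\<Sum>a'\<in>?a. \<Sum>b'\<in>?b. (cmod (\<Sum>a\<in>?a. \<Sum>b\<in>?b. c (a + b) *
        (cnj (fourier_coeff d \<phi>\<^sub>1 (a + a')) * cnj (fourier_coeff d \<phi>\<^sub>2 (b + b')))))\<^sup>2)"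
    unfolding sum_multiindices_split[OF AB]
    by (intro sum.cong refl arg_cong[where f = "\<lambda>x. (cmod x)\<^sup>2"]) (simp only: coeff complex_cnj_mult)
  also have "\<dots> \<le> K\<^sub>1 * K\<^sub>2 * (\<Sum>a\<in>?a. \<Sum>b\<in>?b. (cmod (c (a + b)))\<^sup>2)"
    by (intro tensor_product_bound hankel_matrix_bounded_subset assms subs)
  finally show "(\<Sum>\<beta>\<in>multiindices {1..d} 0 (int n).
      (cmod (\<Sum>\<alpha>\<in>multiindices {1..d} 0 (int n). c \<alpha> * cnj (fourier_coeff d (\<lambda>z. \<phi>\<^sub>1 z * \<phi>\<^sub>2 z) (\<alpha> + \<beta>))))\<^sup>2)
    \<le> K\<^sub>1 * K\<^sub>2 * (\<Sum>\<alpha>\<in>multiindices {1..d} 0 (int n). (cmod (c \<alpha>))\<^sup>2)"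
    unfolding sum_multiindices_split[OF AB] .
qed

lemma sum_H2: "(\<lambda>z. \<phi>\<^sub>1 z + \<phi>\<^sub>2 z) \<in> H2 d"
  unfolding H2_def using H2s by (auto simp: L2_add L2s fourier_coeff_add)

context
  assumes zero: "fourier_coeff d \<phi>\<^sub>1 0 = 0" "fourier_coeff d \<phi>\<^sub>2 0 = 0"
begin

private lemma coeff_zero:
  "\<alpha> \<in> indices d \<Longrightarrow> i \<notin> A \<Longrightarrow> \<alpha> i \<noteq> 0 \<Longrightarrow> fourier_coeff d \<phi>\<^sub>1 \<alpha> = 0"
  "\<alpha> \<in> indices d \<Longrightarrow> i \<notin> B \<Longrightarrow> \<alpha> i \<noteq> 0 \<Longrightarrow> fourier_coeff d \<phi>\<^sub>2 \<alpha> = 0"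
  using fourier_coeff_depends_only_on[OF subs(1) L2s(1) \<phi>\<^sub>1(2), of i \<alpha>]
    fourier_coeff_depends_only_on[OF subs(2) L2s(2) \<phi>\<^sub>2(2), of i \<alpha>]
  unfolding indices_def by blast+

text \<open>A common frequency would be supported in \<open>A\<close> and in \<open>B\<close>, hence
  be 0, where both coefficients vanish; so the two functions are orthogonal.\<close>

lemma L2_norm_sum_square: "(L2_norm d (\<lambda>z. \<phi>\<^sub>1 z + \<phi>\<^sub>2 z))\<^sup>2 = (L2_norm d \<phi>\<^sub>1)\<^sup>2 + (L2_norm d \<phi>\<^sub>2)\<^sup>2"
proof -
  have "L2_inner d \<phi>\<^sub>1 \<phi>\<^sub>2 = 0"
  proof (rule L2_inner_disjoint_spectra[OF L2s])
    fix \<alpha> assume \<alpha>: "\<alpha> \<in> indices d"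
    show "fourier_coeff d \<phi>\<^sub>1 \<alpha> = 0 \<or> fourier_coeff d \<phi>\<^sub>2 \<alpha> = 0"
    proof (cases "\<alpha> = 0")
      case False
      then obtain i where "\<alpha> i \<noteq> 0" by (auto simp: fun_eq_iff)
      then show ?thesis using coeff_zero[OF \<alpha>, of i] AB(1) by blast
    qed (simp add: zero)
  qed
  then show ?thesis by (simp add: L2_norm_add_square L2s)
qed

text \<open>Adding the bounds of the two blocks gives
  \<open>K\<^sub>1 * (w + u) + K\<^sub>2 * (w + v)\<close>, which falls short of
  \<open>(K\<^sub>1 + K\<^sub>2) * (w + (u + v))\<close> by
  \<open>K\<^sub>1 * v + K\<^sub>2 * u\<close>. This slack pays for the cross term in row 0, the
  only row that meets both blocks.\<close>

lemma hankel_matrix_bounded_sum: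
  assumes bd: "hankel_matrix_bounded d \<phi>\<^sub>1 K\<^sub>1" "hankel_matrix_bounded d \<phi>\<^sub>2 K\<^sub>2" and K: "0 \<le> K\<^sub>1" "0 \<le> K\<^sub>2"
  shows "hankel_matrix_bounded d (\<lambda>z. \<phi>\<^sub>1 z + \<phi>\<^sub>2 z) (K\<^sub>1 + K\<^sub>2)"
  unfolding hankel_matrix_bounded_def
proof (intro allI)
  fix n and c :: "(nat \<Rightarrow> int) \<Rightarrow> complex"
  define box where "box X = multiindices X 0 (int n)" for X
  define I where "I = box {1..d}"
  define m\<^sub>1 m\<^sub>2 where "m\<^sub>1 \<gamma> = cnj (fourier_coeff d \<phi>\<^sub>1 \<gamma>)" and "m\<^sub>2 \<gamma> = cnj (fourier_coeff d \<phi>\<^sub>2 \<gamma>)" for \<gamma>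
  define T where "T \<beta> = (\<Sum>\<alpha>\<in>I. c \<alpha> * (m\<^sub>1 (\<alpha> + \<beta>) + m\<^sub>2 (\<alpha> + \<beta>)))" for \<beta>
  have boxI: "box X \<subseteq> I" if "X \<subseteq> {1..d}" for X
    unfolding box_def I_def using that by (intro multiindices_subset_index_set) auto
  have fin: "finite I" "finite (box A)" "finite (box B)"
    using finite_subset[OF subs(1)] finite_subset[OF subs(2)] by (auto simp: I_def box_def)
  have zero_in: "0 \<in> box X" for X by (simp add: box_def multiindices_def)
  have nonneg: "0 \<le> \<alpha> i" if "\<alpha> \<in> I" for \<alpha> i
    using that unfolding I_def box_def by (rule nonneg_if_multiindices)
  have idx: "\<alpha> + \<beta> \<in> indices d" if "\<alpha> \<in> I" "\<beta> \<in> I" for \<alpha> \<beta>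
    using that by (auto simp: I_def box_def multiindices_def indices_def)
  have out: "\<exists>i. i \<notin> X \<and> \<alpha> i \<noteq> 0" if "\<alpha> \<in> I" "\<alpha> \<notin> box X" "X \<subseteq> {1..d}" for \<alpha> X
    using that unfolding I_def box_def multiindices_def by blast
  have m1: "m\<^sub>1 (\<alpha> + \<beta>) = 0" if I: "\<alpha> \<in> I" "\<beta> \<in> I" and notin: "\<alpha> \<notin> box A \<or> \<beta> \<notin> box A" for \<alpha> \<beta>
  proof -
    obtain i where "i \<notin> A" "\<alpha> i \<noteq> 0 \<or> \<beta> i \<noteq> 0"
      using notin out[OF I(1) _ subs(1)] out[OF I(2) _ subs(1)] by blast
    \<comment> \<open>Both entries are nonnegative, so they cannot cancel.\<close>
    moreover from this have "(\<alpha> + \<beta>) i \<noteq> 0"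
      using nonneg[OF I(1), of i] nonneg[OF I(2), of i] by auto
    ultimately show ?thesis using coeff_zero(1)[OF idx[OF I]] by (simp add: m\<^sub>1_def)
  qed
  have m2: "m\<^sub>2 (\<alpha> + \<beta>) = 0" if I: "\<alpha> \<in> I" "\<beta> \<in> I" and notin: "\<alpha> \<notin> box B \<or> \<beta> \<notin> box B" for \<alpha> \<beta>
  proof -
    obtain i where "i \<notin> B" "\<alpha> i \<noteq> 0 \<or> \<beta> i \<noteq> 0"
      using notin out[OF I(1) _ subs(2)] out[OF I(2) _ subs(2)] by blast
    moreover from this have "(\<alpha> + \<beta>) i \<noteq> 0"
      using nonneg[OF I(1), of i] nonneg[OF I(2), of i] by auto
    ultimately show ?thesis using coeff_zero(2)[OF idx[OF I]] by (simp add: m\<^sub>2_def)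
  qed
  have inter: "box A \<inter> box B = {0}"
  proof
    show "box A \<inter> box B \<subseteq> {0}"
    proof
      fix \<alpha> assume \<alpha>: "\<alpha> \<in> box A \<inter> box B"
      have "\<alpha> i = 0" for i
        using \<alpha> AB(1) unfolding box_def multiindices_def by (cases "i \<in> A") blast+
      then show "\<alpha> \<in> {0}" by (simp add: fun_eq_iff)
    qed
  qed (simp add: zero_in)
  define t\<^sub>1 t\<^sub>2 where "t\<^sub>1 \<beta> = (\<Sum>\<alpha>\<in>box A. c \<alpha> * m\<^sub>1 (\<alpha> + \<beta>))" and "t\<^sub>2 \<beta> = (\<Sum>\<alpha>\<in>box B. c \<alpha> * m\<^sub>2 (\<alpha> + \<beta>))" for \<beta>
  \<comment> \<open>Each block acts from the columns of its own box to the rows of that box.\<close>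
  have T: "T \<beta> = (if \<beta> \<in> box A then t\<^sub>1 \<beta> else 0) + (if \<beta> \<in> box B then t\<^sub>2 \<beta> else 0)" if \<beta>: "\<beta> \<in> I" for \<beta>
  proof -
    have "(\<Sum>\<alpha>\<in>I. c \<alpha> * m\<^sub>1 (\<alpha> + \<beta>)) = (if \<beta> \<in> box A then t\<^sub>1 \<beta> else 0)"
    proof (cases "\<beta> \<in> box A")
      case True
      have "(\<Sum>\<alpha>\<in>I. c \<alpha> * m\<^sub>1 (\<alpha> + \<beta>)) = t\<^sub>1 \<beta>"
        unfolding t\<^sub>1_def using fin boxI[OF subs(1)] m1 \<beta> by (intro sum.mono_neutral_right) auto
      then show ?thesis using True by simp
    qed (simp add: m1 \<beta>)
    moreover have "(\<Sum>\<alpha>\<in>I. c \<alpha> * m\<^sub>2 (\<alpha> + \<beta>)) = (if \<beta> \<in> box B then t\<^sub>2 \<beta> else 0)"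
    proof (cases "\<beta> \<in> box B")
      case True
      have "(\<Sum>\<alpha>\<in>I. c \<alpha> * m\<^sub>2 (\<alpha> + \<beta>)) = t\<^sub>2 \<beta>"
        unfolding t\<^sub>2_def using fin boxI[OF subs(2)] m2 \<beta> by (intro sum.mono_neutral_right) auto
      then show ?thesis using True by simp
    qed (simp add: m2 \<beta>)
    ultimately show ?thesis by (simp only: T_def distrib_left sum.distrib)
  qed
  \<comment> \<open>\<open>w\<close> is the share of index 0, which lies in both boxes and therefore
    enters both bounds.\<close>
  define u v w where "u = (\<Sum>\<alpha>\<in>box A - {0}. (cmod (c \<alpha>))\<^sup>2)" and "v = (\<Sum>\<alpha>\<in>box B - {0}. (cmod (c \<alpha>))\<^sup>2)"
    and "w = (cmod (c 0))\<^sup>2"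
  define p q where "p = cmod (t\<^sub>1 0)" and "q = cmod (t\<^sub>2 0)"
  have uvw: "0 \<le> u" "0 \<le> v" "0 \<le> w" by (auto simp: u_def v_def w_def intro: sum_nonneg)
  note bd1 = hankel_matrix_bounded_subset[OF bd(1) subs(1), where n = n, folded box_def m\<^sub>1_def]
    and bd2 = hankel_matrix_bounded_subset[OF bd(2) subs(2), where n = n, folded box_def m\<^sub>2_def]
  have R1: "p\<^sup>2 + (\<Sum>\<beta>\<in>box A - {0}. (cmod (t\<^sub>1 \<beta>))\<^sup>2) \<le> K\<^sub>1 * (w + u)"
    using bd1[of c] unfolding t\<^sub>1_def[symmetric] p_def u_def w_def
      sum.remove[OF fin(2) zero_in, of "\<lambda>\<beta>. (cmod (t\<^sub>1 \<beta>))\<^sup>2"] sum.remove[OF fin(2) zero_in, of "\<lambda>\<beta>. (cmod (c \<beta>))\<^sup>2"] .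
  have R2: "q\<^sup>2 + (\<Sum>\<beta>\<in>box B - {0}. (cmod (t\<^sub>2 \<beta>))\<^sup>2) \<le> K\<^sub>2 * (w + v)"
    using bd2[of c] unfolding t\<^sub>2_def[symmetric] q_def v_def w_def
      sum.remove[OF fin(3) zero_in, of "\<lambda>\<beta>. (cmod (t\<^sub>2 \<beta>))\<^sup>2"] sum.remove[OF fin(3) zero_in, of "\<lambda>\<beta>. (cmod (c \<beta>))\<^sup>2"] .
  have m0: "m\<^sub>1 0 = 0" "m\<^sub>2 0 = 0" by (simp_all add: m\<^sub>1_def m\<^sub>2_def zero)
  \<comment> \<open>Since the entry \<open>m\<^sub>1 0\<close> is 0, setting \<open>c 0\<close> to 0
    leaves \<open>p\<close> unchanged and removes \<open>w\<close> from the bound; the slack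
    contains no multiple of \<open>w\<close>.\<close>
  have P: "p\<^sup>2 \<le> K\<^sub>1 * u"
  proof -
    let ?c = "c(0 := 0)"
    have "t\<^sub>1 0 = (\<Sum>\<alpha>\<in>box A. ?c \<alpha> * m\<^sub>1 (\<alpha> + 0))"
      unfolding t\<^sub>1_def by (intro sum.cong refl) (auto simp: m0)
    then have "p\<^sup>2 \<le> (\<Sum>\<beta>\<in>box A. (cmod (\<Sum>\<alpha>\<in>box A. ?c \<alpha> * m\<^sub>1 (\<alpha> + \<beta>)))\<^sup>2)"
      unfolding p_def using fin zero_in
      by (simp only:) (rule member_le_sum[of 0 "box A" "\<lambda>\<beta>. (cmod (\<Sum>\<alpha>\<in>box A. ?c \<alpha> * m\<^sub>1 (\<alpha> + \<beta>)))\<^sup>2"], auto)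
    also have "\<dots> \<le> K\<^sub>1 * (\<Sum>\<alpha>\<in>box A. (cmod (?c \<alpha>))\<^sup>2)" by (rule bd1)
    also have "(\<Sum>\<alpha>\<in>box A. (cmod (?c \<alpha>))\<^sup>2) = u"
      unfolding u_def sum.remove[OF fin(2) zero_in] by (auto intro!: sum.cong)
    finally show ?thesis .
  qed
  have Q: "q\<^sup>2 \<le> K\<^sub>2 * v"
  proof -
    let ?c = "c(0 := 0)"
    have "t\<^sub>2 0 = (\<Sum>\<alpha>\<in>box B. ?c \<alpha> * m\<^sub>2 (\<alpha> + 0))"
      unfolding t\<^sub>2_def by (intro sum.cong refl) (auto simp: m0)
    then have "q\<^sup>2 \<le> (\<Sum>\<beta>\<in>box B. (cmod (\<Sum>\<alpha>\<in>box B. ?c \<alpha> * m\<^sub>2 (\<alpha> + \<beta>)))\<^sup>2)"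
      unfolding q_def using fin zero_in
      by (simp only:) (rule member_le_sum[of 0 "box B" "\<lambda>\<beta>. (cmod (\<Sum>\<alpha>\<in>box B. ?c \<alpha> * m\<^sub>2 (\<alpha> + \<beta>)))\<^sup>2"], auto)
    also have "\<dots> \<le> K\<^sub>2 * (\<Sum>\<alpha>\<in>box B. (cmod (?c \<alpha>))\<^sup>2)" by (rule bd2)
    also have "(\<Sum>\<alpha>\<in>box B. (cmod (?c \<alpha>))\<^sup>2) = v"
      unfolding v_def sum.remove[OF fin(3) zero_in] by (auto intro!: sum.cong)
    finally show ?thesis .
  qed
  \<comment> \<open>Arithmetic and geometric means, after exchanging \<open>u\<close> and
    \<open>v\<close> in \<open>(K\<^sub>1 * u) * (K\<^sub>2 * v)\<close>.\<close>
  have PQ: "2 * (p * q) \<le> K\<^sub>1 * v + K\<^sub>2 * u"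
  proof (rule power2_le_imp_le)
    have "p\<^sup>2 * q\<^sup>2 \<le> (K\<^sub>1 * u) * (K\<^sub>2 * v)"
      using P Q K uvw by (intro mult_mono) auto
    moreover have "4 * ((K\<^sub>1 * v) * (K\<^sub>2 * u)) \<le> (K\<^sub>1 * v + K\<^sub>2 * u)\<^sup>2"
      using sum_squares_bound[of "K\<^sub>1 * v" "K\<^sub>2 * u"] by (simp add: power2_sum mult_ac)
    ultimately show "(2 * (p * q))\<^sup>2 \<le> (K\<^sub>1 * v + K\<^sub>2 * u)\<^sup>2"
      by (simp add: power_mult_distrib mult_ac)
    show "0 \<le> K\<^sub>1 * v + K\<^sub>2 * u" using K uvw by simp
  qed
  have disj: "(box A - {0}) \<inter> (box B - {0}) = {}" using inter by blast
  have exclusive: "\<beta> \<in> box A \<Longrightarrow> \<beta> \<noteq> 0 \<Longrightarrow> \<beta> \<notin> box B" "\<beta> \<in> box B \<Longrightarrow> \<beta> \<noteq> 0 \<Longrightarrow> \<beta> \<notin> box A" for \<beta>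
    using inter by blast+
  have union: "insert 0 ((box A - {0}) \<union> (box B - {0})) \<subseteq> I"
    using boxI[OF subs(1)] boxI[OF subs(2)] zero_in by auto
  have split: "(\<Sum>\<beta>\<in>insert 0 ((box A - {0}) \<union> (box B - {0})). F \<beta>) =
      F 0 + ((\<Sum>\<beta>\<in>box A - {0}. F \<beta>) + (\<Sum>\<beta>\<in>box B - {0}. F \<beta>))" for F :: "_ \<Rightarrow> real"
    using fin disj by (subst sum.insert) (auto simp: sum.union_disjoint)
  have "(\<Sum>\<beta>\<in>I. (cmod (T \<beta>))\<^sup>2) = (\<Sum>\<beta>\<in>insert 0 ((box A - {0}) \<union> (box B - {0})). (cmod (T \<beta>))\<^sup>2)"
    using union fin T by (intro sum.mono_neutral_right) auto
  also have "\<dots> = (cmod (T 0))\<^sup>2 + ((\<Sum>\<beta>\<in>box A - {0}. (cmod (T \<beta>))\<^sup>2) + (\<Sum>\<beta>\<in>box B - {0}. (cmod (T \<beta>))\<^sup>2))"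
    by (rule split)
  also have "(\<Sum>\<beta>\<in>box A - {0}. (cmod (T \<beta>))\<^sup>2) = (\<Sum>\<beta>\<in>box A - {0}. (cmod (t\<^sub>1 \<beta>))\<^sup>2)"
    using union T exclusive by (intro sum.cong refl) (simp add: subset_iff)
  also have "(\<Sum>\<beta>\<in>box B - {0}. (cmod (T \<beta>))\<^sup>2) = (\<Sum>\<beta>\<in>box B - {0}. (cmod (t\<^sub>2 \<beta>))\<^sup>2)"
    using union T exclusive by (intro sum.cong refl) (simp add: subset_iff)
  finally have total: "(\<Sum>\<beta>\<in>I. (cmod (T \<beta>))\<^sup>2) = (cmod (T 0))\<^sup>2 +
    ((\<Sum>\<beta>\<in>box A - {0}. (cmod (t\<^sub>1 \<beta>))\<^sup>2) + (\<Sum>\<beta>\<in>box B - {0}. (cmod (t\<^sub>2 \<beta>))\<^sup>2))" .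
  have "T 0 = t\<^sub>1 0 + t\<^sub>2 0" using T[of 0] union zero_in by simp
  then have "(cmod (T 0))\<^sup>2 \<le> (p + q)\<^sup>2"
    unfolding p_def q_def by (auto intro!: power_mono norm_triangle_ineq)
  also have "\<dots> = p\<^sup>2 + q\<^sup>2 + 2 * (p * q)" by (simp add: power2_sum)
  finally have "(\<Sum>\<beta>\<in>I. (cmod (T \<beta>))\<^sup>2) \<le> K\<^sub>1 * (w + u) + K\<^sub>2 * (w + v) + (K\<^sub>1 * v + K\<^sub>2 * u)"
    using total R1 R2 PQ by linarith
  also have "\<dots> = (K\<^sub>1 + K\<^sub>2) * (w + (u + v))" by (simp add: algebra_simps)
  also have "w + (u + v) = (\<Sum>\<alpha>\<in>insert 0 ((box A - {0}) \<union> (box B - {0})). (cmod (c \<alpha>))\<^sup>2)"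
    unfolding split u_def v_def w_def ..
  \<comment> \<open>The mixed indices, outside both boxes, carry no entries of the matrix; their
    coefficients only enlarge the right-hand side.\<close>
  also have "(K\<^sub>1 + K\<^sub>2) * \<dots> \<le> (K\<^sub>1 + K\<^sub>2) * (\<Sum>\<alpha>\<in>I. (cmod (c \<alpha>))\<^sup>2)"
    using K fin union by (intro mult_left_mono sum_mono2) auto
  finally show "(\<Sum>\<beta>\<in>multiindices {1..d} 0 (int n).
      (cmod (\<Sum>\<alpha>\<in>multiindices {1..d} 0 (int n). c \<alpha> * cnj (fourier_coeff d (\<lambda>z. \<phi>\<^sub>1 z + \<phi>\<^sub>2 z) (\<alpha> + \<beta>))))\<^sup>2)
    \<le> (K\<^sub>1 + K\<^sub>2) * (\<Sum>\<alpha>\<in>multiindices {1..d} 0 (int n). (cmod (c \<alpha>))\<^sup>2)"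
    by (simp only: T_def I_def box_def m\<^sub>1_def m\<^sub>2_def fourier_coeff_add[OF L2s] complex_cnj_add)
qed

end

end

theorem theorem2:
  fixes d :: nat and \<phi>\<^sub>1 \<phi>\<^sub>2 :: "(nat \<Rightarrow> complex) \<Rightarrow> complex"
  assumes "\<phi>\<^sub>1 \<in> H2 d" and "\<phi>\<^sub>2 \<in> H2 d"
    and "separate_variables d \<phi>\<^sub>1 \<phi>\<^sub>2"
    and "hankel_minimal_norm d \<phi>\<^sub>1" and "hankel_minimal_norm d \<phi>\<^sub>2"
  shows "hankel_minimal_norm d (\<lambda>z. \<phi>\<^sub>1 z * \<phi>\<^sub>2 z) \<and>
    (fourier_coeff d \<phi>\<^sub>1 (\<lambda>_. 0) = 0 \<and> fourier_coeff d \<phi>\<^sub>2 (\<lambda>_. 0) = 0 \<longrightarrow>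
      hankel_minimal_norm d (\<lambda>z. \<phi>\<^sub>1 z + \<phi>\<^sub>2 z))"
proof -
  obtain A B' where AB': "A \<subseteq> {1..d}" "B' \<subseteq> {1..d}" "A \<inter> B' = {}"
    and A: "depends_only_on d A \<phi>\<^sub>1" and B': "depends_only_on d B' \<phi>\<^sub>2"
    using assms(3) unfolding separate_variables_def by blast
  \<comment> \<open>\<open>B'\<close> is enlarged to the complement of \<open>A\<close>, because
    splitting the torus takes two sets that cover \<open>{1..d}\<close>.\<close>
  define B where "B = {1..d} - A"
  have AB: "A \<inter> B = {}" "A \<union> B = {1..d}" using AB'(1) by (auto simp: B_def)
  have B: "depends_only_on d B \<phi>\<^sub>2"
    using B' by (rule depends_only_on_mono) (use AB' in \<open>auto simp: B_def\<close>)
  have L2: "\<phi>\<^sub>1 \<in> L2 d" "\<phi>\<^sub>2 \<in> L2 d" using assms(1,2) by (simp_all add: H2_def)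
  note setting = AB assms(1) A assms(2) B
  note bounded = assms(4)[unfolded hankel_minimal_norm_iff[OF assms(1)]]
    assms(5)[unfolded hankel_minimal_norm_iff[OF assms(2)]]
  have "hankel_minimal_norm d (\<lambda>z. \<phi>\<^sub>1 z * \<phi>\<^sub>2 z)"
    unfolding hankel_minimal_norm_iff[OF product_H2[OF setting]]
      separate_variables_mult(2)[OF AB L2(1) A L2(2) B]
    by (intro hankel_matrix_bounded_product[OF setting] bounded) simp
  moreover have "hankel_minimal_norm d (\<lambda>z. \<phi>\<^sub>1 z + \<phi>\<^sub>2 z)"
    if "fourier_coeff d \<phi>\<^sub>1 (\<lambda>_. 0) = 0" "fourier_coeff d \<phi>\<^sub>2 (\<lambda>_. 0) = 0"
  proof -
    note zero = that[folded zero_fun_def]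
    show ?thesis
      unfolding hankel_minimal_norm_iff[OF sum_H2[OF setting]] L2_norm_sum_square[OF setting zero]
      by (intro hankel_matrix_bounded_sum[OF setting zero] bounded) simp_all
  qed
  ultimately show ?thesis by blast
qed


end
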